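(* Let $\Omega=[\mathbb{X},\mathbb{L},\mathbb{P}]$ be any constellation. The first-order coefficient $\alpha$ of the BICM capacity $\mathsf{I}^{\mathrm{BI}}_\Omega(\mathsf{SNR})$, i.e. the number $\alpha^{\mathrm{BI}}_\Omega$ such that $\mathsf{I}^{\mathrm{BI}}_\Omega(\mathsf{SNR})=\alpha^{\mathrm{BI}}_\Omega\,\mathsf{SNR}+O(\mathsf{SNR}^2)$ as $\mathsf{SNR}\to 0$, is given by $$\alpha^{\mathrm{BI}}_\Omega=\frac{\log_2 e}{E_s}\left[\sum_{k=0}^{m-1}\sum_{u\in\{0,1\}}P_{C_k}(u)\,\bigl\|\mathbb{E}[\boldsymbol{X}\mid C_k=u]\bigr\|^2-m\,\bigl\|\mathbb{E}[\boldsymbol{X}]\bigr\|^2\right].$$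
   Context: Constellations. Fix integers $m,N\ge 1$ and let $M=2^m$. An input alphabet $\mathbb{X}$ is an $M\times N$ real matrix whose rows $\boldsymbol{x}_0,\ldots,\boldsymbol{x}_{M-1}\in\mathbb{R}^N$ (row vectors) are pairwise distinct. A binary labeling $\mathbb{L}$ of order $m$ is an $M\times m$ matrix whose rows $\boldsymbol{c}_i=[c_{i,0},\ldots,c_{i,m-1}]$, $i=0,\ldots,M-1$, are the $M$ distinct elements of $\{0,1\}^m$. Let $C_0,\ldots,C_{m-1}$ be independent $\{0,1\}$-valued random variables with pmfs $P_{C_k}$; the transmitted symbol is $\boldsymbol{X}=\boldsymbol{x}_i$ when $[C_0,\ldots,C_{m-1}]=\boldsymbol{c}_i$. The input distribution is $\mathbb{P}=[P_{\boldsymbol{X}}(\boldsymbol{x}_0),\ldots,P_{\boldsymbol{X}}(\boldsymbol{x}_{M-1})]^{T}$ with $P_{\boldsymbol{X}}(\boldsymbol{x}_i)=\prod_{k=0}^{m-1}P_{C_k}(c_{i,k})$. A constellation is $\Omega=[\mathbb{X},\mathbb{L},\mathbb{P}]$. Put $E_s=\mathbb{E}[\|\boldsymbol{X}\|^2]$, assumed positive. A term with $P_{C_k}(u)=0$ in a sum weighted by $P_{C_k}(u)$ is read as $0$. Channel. $\boldsymbol{Y}=\boldsymbol{H}\circ\boldsymbol{X}+\boldsymbol{Z}$, where $\circ$ is the element-wise product, $\boldsymbol{X},\boldsymbol{H},\boldsymbol{Z}$ are mutually independent, $\boldsymbol{Z}$ is Gaussian in $\mathbb{R}^N$ with independent zero-mean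 components of variance $N_0/2$, and $\boldsymbol{H}$ is a real random vector whose $N$ components (possibly dependent) all have the same distribution, that of a random variable $H$, with $0<\mathbb{E}[H^2]<\infty$. It is assumed that there is $\omega>0$ such that $\Pr\{\|\boldsymbol{H}\|^2>\Delta\}\le\exp(-\Delta^\omega)$ for all sufficiently large $\Delta>0$. $\boldsymbol{H}$ and $N_0$ are known at the receiver. Define $\mathsf{SNR}=\mathbb{E}[H^2]\,E_s/N_0$. The constellation and the law of $\boldsymbol{H}$ are fixed and $N_0$ varies over $(0,\infty)$, so $\mathsf{SNR}\to0$ means $N_0\to\infty$. BICM capacity (in bits, channel known at the receiver). $$\mathsf{I}^{\mathrm{BI}}_\Omega(\mathsf{SNR})=\sum_{k=0}^{m-1}\mathbb{E}_{C_k,\boldsymbol{H},\boldsymbol{Y}}\left[\log_2\frac{p_{\boldsymbol{Y}|C_k,\boldsymbol{H}}(\boldsymbol{Y})}{p_{\boldsymbol{Y}|\boldsymbol{H}}(\boldsymbol{Y})}\right].$$ *)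

theory Defs
  imports "HOL-Probability.Probability" "HOL-Library.Landau_Symbols"
begin

text \<open>
  A constellation is given by the alphabet rows \<open>x i\<close> (\<open>i < 2 ^ m\<close>), the labels \<open>c i k\<close>
  (\<open>k < m\<close>), and the laws of the independent bits \<open>C k\<close>, which determine the law of the
  transmitted symbol \<open>X\<close>. Only indices \<open>i < 2 ^ m\<close> and \<open>k < m\<close> are relevant.
\<close>

locale constellation = prob_space M
  for M :: "'w measure" +
  fixes m :: nat
    and x :: "nat \<Rightarrow> real ^ 'n"
    and c :: "nat \<Rightarrow> nat \<Rightarrow> nat"
    and C :: "nat \<Rightarrow> 'w \<Rightarrow> nat"
    and X :: "'w \<Rightarrow> real ^ 'n"
  assumes order_pos: "1 \<le> m"
    and alphabet_distinct: "inj_on x {..<2 ^ m}"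
    and labeling:
      "bij_betw (\<lambda>i. restrict (c i) {..<m}) {..<2 ^ m} ({..<m} \<rightarrow>\<^sub>E {0, 1})"
    and bits_indep: "indep_vars (\<lambda>_. count_space {0, 1}) C {..<m}"
    and symbol: "\<And>w i. w \<in> space M \<Longrightarrow> i < 2 ^ m \<Longrightarrow> (\<forall>k<m. C k w = c i k) \<Longrightarrow> X w = x i"
    and energy_pos: "0 < expectation (\<lambda>w. (norm (X w))\<^sup>2)"

text \<open>
  The measure \<open>PH\<close> is the common law of the components of the fading vector. The noise level
  \<open>N0\<close> varies while everything else is fixed, so the noise is a family \<open>Z N0\<close>; nothing is
  assumed about its joint behaviour for different values of \<open>N0\<close>.
\<close>

locale fading_bicm = constellation M m x c C X
  for M :: "'w measure"
    and m :: nat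
    and x :: "nat \<Rightarrow> real ^ 'n"
    and c :: "nat \<Rightarrow> nat \<Rightarrow> nat"
    and C :: "nat \<Rightarrow> 'w \<Rightarrow> nat"
    and X :: "'w \<Rightarrow> real ^ 'n" +
  fixes H :: "'w \<Rightarrow> real ^ 'n"
    and PH :: "real measure"
    and Z :: "real \<Rightarrow> 'w \<Rightarrow> real ^ 'n"
  assumes fading_law: "\<And>j. distr M borel (\<lambda>w. H w $ j) = PH"
    and fading_square_integrable: "integrable PH (\<lambda>h. h\<^sup>2)"
    and fading_power_pos: "0 < (\<integral>h. h\<^sup>2 \<partial>PH)"
    and fading_tail:
      "\<exists>r>0. \<forall>\<^sub>F d in at_top. prob {w \<in> space M. (norm (H w))\<^sup>2 > d} \<le> exp (- (d powr r))"
    and noise_gaussian: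
      "\<And>N0 j. 0 < N0 \<Longrightarrow>
        distributed M lborel (\<lambda>w. Z N0 w $ j) (normal_density 0 (sqrt (N0 / 2)))"
    and noise_components_indep:
      "\<And>N0. 0 < N0 \<Longrightarrow> indep_vars (\<lambda>_. borel) (\<lambda>j w. Z N0 w $ j) UNIV"
    and input_fading_noise_indep:
      "\<And>N0. 0 < N0 \<Longrightarrow> indep_vars (\<lambda>_. borel) (\<lambda>i. [X, H, Z N0] ! i) {..<3}"

definition channel_output ::
    "('w \<Rightarrow> real ^ 'n) \<Rightarrow> ('w \<Rightarrow> real ^ 'n) \<Rightarrow> ('w \<Rightarrow> real ^ 'n) \<Rightarrow> 'w \<Rightarrow> real ^ 'n"
  where "channel_output H X Z w = (\<chi> j. H w $ j * X w $ j) + Z w"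

text \<open>
  The conditional density \<open>p(y | t)\<close> of \<open>Y\<close> given \<open>T = t\<close>, where \<open>T\<close> takes values in \<open>S\<close>:
  the function with \<open>P(T \<in> A, Y \<in> B) = \<integral>\<^sub>A \<integral>\<^sub>B p(y | t) dy P\<^sub>T(dt)\<close>, that is, the
  Radon-Nikodym derivative of the joint law of \<open>(T, Y)\<close> with respect to the product of the law
  of \<open>T\<close> with Lebesgue measure. It is determined up to null sets of that product.
\<close>

definition cond_density ::
    "'w measure \<Rightarrow> 't measure \<Rightarrow> ('w \<Rightarrow> 't) \<Rightarrow> ('w \<Rightarrow> 'y::euclidean_space) \<Rightarrow> 't \<Rightarrow> 'y \<Rightarrow> real"
  where
    "cond_density M S T Y t y =
      enn2real (RN_deriv (distr M S T \<Otimes>\<^sub>M lborel)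
        (distr M (S \<Otimes>\<^sub>M borel) (\<lambda>w. (T w, Y w))) (t, y))"

definition bicm_information ::
    "'w measure \<Rightarrow> nat \<Rightarrow> (nat \<Rightarrow> 'w \<Rightarrow> nat) \<Rightarrow> ('w \<Rightarrow> real ^ 'n) \<Rightarrow> ('w \<Rightarrow> real ^ 'n) \<Rightarrow> real"
  where
    "bicm_information M m C H Y =
      (\<Sum>k<m. \<integral>w. log 2
         (cond_density M (count_space {0, 1} \<Otimes>\<^sub>M borel) (\<lambda>w. (C k w, H w)) Y (C k w, H w) (Y w)
          / cond_density M borel H Y (H w) (Y w)) \<partial>M)"

definition symbol_energy :: "'w measure \<Rightarrow> ('w \<Rightarrow> real ^ 'n) \<Rightarrow> real"
  where "symbol_energy M X = (\<integral>w. (norm (X w))\<^sup>2 \<partial>M)"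

definition snr :: "'w measure \<Rightarrow> ('w \<Rightarrow> real ^ 'n) \<Rightarrow> real measure \<Rightarrow> real \<Rightarrow> real"
  where "snr M X PH N0 = (\<integral>h. h\<^sup>2 \<partial>PH) * symbol_energy M X / N0"

text \<open>
  The capacity is a function of the signal-to-noise ratio \<open>s\<close>; the corresponding noise level is
  \<open>N0 = E[H\<^sup>2] E\<^sub>s / s\<close>.
\<close>

definition bicm_capacity ::
    "'w measure \<Rightarrow> nat \<Rightarrow> (nat \<Rightarrow> 'w \<Rightarrow> nat) \<Rightarrow> ('w \<Rightarrow> real ^ 'n) \<Rightarrow> ('w \<Rightarrow> real ^ 'n)
      \<Rightarrow> real measure \<Rightarrow> (real \<Rightarrow> 'w \<Rightarrow> real ^ 'n) \<Rightarrow> real \<Rightarrow> real"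
  where
    "bicm_capacity M m C X H PH Z s =
      (let N0 = (\<integral>h. h\<^sup>2 \<partial>PH) * symbol_energy M X / s
       in bicm_information M m C H (channel_output H X (Z N0)))"

lemma (in fading_bicm) bicm_capacity_snr:
  assumes "0 < N0"
  shows "0 < snr M X PH N0"
    and "bicm_capacity M m C X H PH Z (snr M X PH N0) =
      bicm_information M m C H (channel_output H X (Z N0))"
  using assms fading_power_pos energy_pos
  by (simp_all add: snr_def bicm_capacity_def symbol_energy_def)

definition first_order_coefficient :: "(real \<Rightarrow> real) \<Rightarrow> real \<Rightarrow> bool"
  where
    "first_order_coefficient f a \<longleftrightarrow> (\<lambda>s. f s - a * s) \<in> O[at_right 0](\<lambda>s. s\<^sup>2)"

text \<open>
  The conditional expectation given an event \<open>A\<close>. It is only meaningful when \<open>A\<close> has positive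
  probability; for a null event it is \<open>0\<close>.
\<close>

definition event_expectation :: "'w measure \<Rightarrow> 'w set \<Rightarrow> ('w \<Rightarrow> real ^ 'n) \<Rightarrow> real ^ 'n"
  where "event_expectation M A X = (\<integral>w. X w \<partial>uniform_measure M A)"

end

theory Submission
  imports Defs "HOL-Real_Asymp.Real_Asymp"
begin

text \<open>
  Up to null sets, the conditional density of \<open>Y\<close> given \<open>C k = u\<close>, \<open>H = h\<close> is the noise density
  \<open>\<phi>\<close> times a mixture \<open>L\<close> of exponential tilts with shifts \<open>h \<circ> x i\<close>. Writing
  \<open>log (p(Y | C k, H) / p(Y | H))\<close> as a difference of two logarithms of such mixtures reduces the
  information to averages over \<open>H\<close> of relative entropies \<open>\<integral> L ln L \<phi>\<close> of Gaussian mixtures with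
  respect to the noise. With \<open>\<delta> = max \<parallel>h \<circ> x i\<parallel>\<^sup>2 / \<sigma>\<^sup>2\<close>, such an entropy is
  \<open>\<parallel>h \<circ> E[X | C k = u]\<parallel>\<^sup>2 / (2 \<sigma>\<^sup>2) + O(\<delta>\<^sup>2)\<close>, with a universal constant: for small \<open>\<delta>\<close> compare
  \<open>t ln t\<close> with its Taylor polynomials at \<open>1\<close> and compute the moments of \<open>L - 1\<close>; for large \<open>\<delta>\<close> the
  entropy lies between \<open>0\<close> and a multiple of \<open>\<delta>\<close>. This bound for all \<open>\<delta>\<close> matters because exponential
  moments of the fading need not exist, whereas the fourth moment is finite by the tail assumption.
\<close>

section \<open>Relative entropy of a mixture of exponential tilts\<close>

text \<open>The difference L - 1 has size of order sqrt \<delta>, so a third-order remainder bounded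
  in absolute value would leave an error of order \<delta> to the power 3/2, too large for O(SNR
  squared). The cubic term is therefore kept with its sign: the polynomials that bound t ln t from
  both sides agree up to degree three and differ by a quartic only. Products of tilts are multiples
  of tilts, so all moments of L - 1 are averages of combinations of exponentials of inner products.
  In the third and fourth moments the constant and linear parts of these exponentials cancel; in the
  second moment the linear part survives and is the leading term. Two further points shape the
  probabilistic half. The conditional densities are Radon-Nikodym derivatives, so they can be
  identified only almost surely along the law of the pair they are evaluated at. And independence
  from fading and noise is given for the symbol X, not for the bits; since the alphabet is distinct,
  the transmitted index is a function of X, and it determines the bits.\<close>

text \<open>The derivative of the right side minus the left side is (t - 1)^3 / t, which has the
  sign of t - 1; hence the difference has its minimum, zero, at t = 1.\<close>

lemma ln_le_cubic:
  fixes t :: real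
  assumes "0 < t"
  shows "ln t \<le> (t - 1) - (t - 1)\<^sup>2 / 2 + (t - 1) ^ 3 / 3"
proof -
  define d where "d = (\<lambda>t::real. (t - 1) - (t - 1)\<^sup>2 / 2 + (t - 1) ^ 3 / 3 - ln t)"
  have der: "(d has_real_derivative (t - 1) ^ 3 / t) (at t)" if "0 < t" for t
    unfolding d_def using that
    by (auto intro!: derivative_eq_intros simp: field_simps power2_eq_square power3_eq_cube)
  have "d 1 \<le> d t"
  proof (cases "1 \<le> t")
    case True
    show ?thesis
    proof (rule DERIV_nonneg_imp_nondecreasing[OF True])
      fix y :: real assume "1 \<le> y" "y \<le> t"
      then show "\<exists>z. (d has_real_derivative z) (at y) \<and> 0 \<le> z"
        by (intro exI[of _ "(y - 1) ^ 3 / y"]) (auto intro!: der)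
    qed
  next
    case False
    show ?thesis
    proof (rule DERIV_nonpos_imp_nonincreasing[of t 1])
      show "t \<le> 1" using False by simp
      fix y :: real assume y: "t \<le> y" "y \<le> 1"
      then have "(y - 1) ^ 3 \<le> 0" by (simp add: power_le_zero_eq)
      then show "\<exists>z. (d has_real_derivative z) (at y) \<and> z \<le> 0"
        using y assms by (intro exI[of _ "(y - 1) ^ 3 / y"]) (auto intro!: der divide_nonpos_pos)
    qed
  qed
  then show ?thesis by (simp add: d_def)
qed

lemma mult_ln_le_quartic:
  fixes t :: real
  assumes "0 < t"
  shows "t * ln t \<le> (t - 1) + (t - 1)\<^sup>2 / 2 - (t - 1) ^ 3 / 6 + (t - 1) ^ 4 / 3"
proof -
  have "t * ln t \<le> t * ((t - 1) - (t - 1)\<^sup>2 / 2 + (t - 1) ^ 3 / 3)"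
    using ln_le_cubic[OF assms] assms by (intro mult_left_mono) auto
  also have "\<dots> = (t - 1) + (t - 1)\<^sup>2 / 2 - (t - 1) ^ 3 / 6 + (t - 1) ^ 4 / 3"
    by (simp add: field_simps power2_eq_square power3_eq_cube power4_eq_xxxx)
  finally show ?thesis .
qed

text \<open>The difference has derivative \<open>e\<close>, and \<open>e\<close> is itself
  increasing with e 1 = 0, so the sign of \<open>e\<close> is that of t - 1 and the minimum is again
  at 1. The polynomial is the cubic part of the upper bound in
  \<open>mult_ln_le_quartic\<close>.\<close>

lemma mult_ln_ge_cubic:
  fixes t :: real
  assumes "0 < t"
  shows "(t - 1) + (t - 1)\<^sup>2 / 2 - (t - 1) ^ 3 / 6 \<le> t * ln t"
proof -
  define e where "e = (\<lambda>t::real. ln t - (t - 1) + (t - 1)\<^sup>2 / 2)"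
  have dere: "(e has_real_derivative (t - 1)\<^sup>2 / t) (at t)" if "0 < t" for t
    unfolding e_def using that
    by (auto intro!: derivative_eq_intros simp: field_simps power2_eq_square)
  have mono_e: "e s \<le> e t" if "0 < s" "s \<le> t" for s t
  proof (rule DERIV_nonneg_imp_nondecreasing[OF that(2)])
    fix y :: real assume "s \<le> y" "y \<le> t"
    then show "\<exists>z. (e has_real_derivative z) (at y) \<and> 0 \<le> z"
      using that by (intro exI[of _ "(y - 1)\<^sup>2 / y"]) (auto intro!: dere)
  qed
  define d where "d = (\<lambda>t::real. t * ln t - (t - 1) - (t - 1)\<^sup>2 / 2 + (t - 1) ^ 3 / 6)"
  have der: "(d has_real_derivative e t) (at t)" if "0 < t" for t
    unfolding d_def e_def using that
    by (auto intro!: derivative_eq_intros simp: field_simps power2_eq_square)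
  have e1: "e 1 = 0" by (simp add: e_def)
  have "d 1 \<le> d t"
  proof (cases "1 \<le> t")
    case True
    show ?thesis
    proof (rule DERIV_nonneg_imp_nondecreasing[OF True])
      fix y :: real assume "1 \<le> y" "y \<le> t"
      then show "\<exists>z. (d has_real_derivative z) (at y) \<and> 0 \<le> z"
        using mono_e[of 1 y] e1 by (intro exI[of _ "e y"]) (auto intro!: der)
    qed
  next
    case False
    show ?thesis
    proof (rule DERIV_nonpos_imp_nonincreasing[of t 1])
      show "t \<le> 1" using False by simp
      fix y :: real assume "t \<le> y" "y \<le> 1"
      then show "\<exists>z. (d has_real_derivative z) (at y) \<and> z \<le> 0"
        using assms mono_e[of y 1] e1 by (intro exI[of _ "e y"]) (auto intro!: der)
    qed
  qed
  then show ?thesis by (simp add: d_def)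
qed

lemma abs_exp_minus_affine_le:
  fixes x :: real
  assumes "\<bar>x\<bar> \<le> 1"
  shows "\<bar>exp x - 1 - x\<bar> \<le> x\<^sup>2"
proof -
  have "exp x \<le> 1 + x + x\<^sup>2"
  proof (cases "0 \<le> x")
    case True
    then show ?thesis using exp_bound[of x] assms by simp
  next
    case False
    define y where "y = - x"
    have y: "0 < y" "y \<le> 1" using False assms by (auto simp: y_def)
    \<comment> \<open>For negative arguments the claim is exp (- y) \<le> 1 - y + y^2. Multiplying
      by exp y and bounding it below by its quadratic Taylor polynomial leaves a polynomial
      inequality.\<close>
    have "1 \<le> (1 - y + y\<^sup>2) * (1 + y + y\<^sup>2 / 2)"
    proof -
      have "(1 - y + y\<^sup>2) * (1 + y + y\<^sup>2 / 2) = 1 + y\<^sup>2 / 2 + y ^ 3 / 2 + y ^ 4 / 2"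
        by (simp add: field_simps power2_eq_square power3_eq_cube power4_eq_xxxx)
      then show ?thesis using y by simp
    qed
    also have "\<dots> \<le> (1 - y + y\<^sup>2) * exp y"
      using exp_lower_Taylor_quadratic[of y] y by (intro mult_left_mono) auto
    finally have "exp (- y) \<le> 1 - y + y\<^sup>2"
      by (simp add: exp_minus field_simps)
    then show ?thesis by (simp add: y_def)
  qed
  then show ?thesis using exp_ge_add_one_self[of x] zero_le_power2[of x] by linarith
qed

text \<open>By convexity: the left side is the tangent of t ln t at b, evaluated at a.\<close>

lemma mult_ln_tangent:
  fixes a b :: real
  assumes "0 < a" "0 < b"
  shows "a * ln b + a - b \<le> a * ln a"
proof -
  have "ln (b / a) \<le> b / a - 1"
    using assms by (intro ln_le_minus_one) simp
  then have "a * (ln b - ln a) \<le> a * (b / a - 1)"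
    using assms by (intro mult_left_mono) (auto simp: ln_div)
  then show ?thesis using assms by (simp add: algebra_simps)
qed

text \<open>Jensen's inequality for t ln t, obtained by averaging the tangent at the mean L, whose
  linear parts cancel.\<close>

lemma mult_ln_sum_le:
  fixes q f :: "'i \<Rightarrow> real"
  assumes "finite J" "\<And>j. j \<in> J \<Longrightarrow> 0 \<le> q j" "sum q J = 1" "\<And>j. j \<in> J \<Longrightarrow> 0 < f j"
  defines "L \<equiv> \<Sum>j\<in>J. q j * f j"
  assumes "0 < L"
  shows "L * ln L \<le> (\<Sum>j\<in>J. q j * (f j * ln (f j)))"
proof -
  have "L * ln L = (\<Sum>j\<in>J. q j * (f j * ln L + f j - L))"
  proof -
    have "(\<Sum>j\<in>J. q j * (f j * ln L + f j - L)) = L * ln L + L - L * sum q J"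
      by (simp add: L_def right_diff_distrib distrib_left sum.distrib sum_subtractf
          mult.assoc[symmetric] flip: sum_distrib_right)
    then show ?thesis using assms by simp
  qed
  also have "\<dots> \<le> (\<Sum>j\<in>J. q j * (f j * ln (f j)))"
    using assms by (intro sum_mono mult_left_mono mult_ln_tangent) auto
  finally show ?thesis .
qed

lemma power4_sum_le:
  fixes q f :: "'i \<Rightarrow> real"
  assumes "finite J" "\<And>j. j \<in> J \<Longrightarrow> 0 \<le> q j" "sum q J = 1"
  shows "(\<Sum>j\<in>J. q j * f j) ^ 4 \<le> (\<Sum>j\<in>J. q j * f j ^ 4)"
proof -
  have "J \<noteq> {}" using assms(3) by auto
  with convex_on_sum[of J UNIV "\<lambda>x::real. x ^ 4" q f] assms convex_power_even[of 4]
  show ?thesis by simp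
qed

section \<open>Exponential tilts and their moments\<close>

text \<open>The density of the normal law with mean \<open>v w\<close> and covariance \<open>v I\<close> relative to the centred one.\<close>

definition gauss_tilt :: "real \<Rightarrow> 'a::euclidean_space \<Rightarrow> 'a \<Rightarrow> real"
  where "gauss_tilt v w z = exp (z \<bullet> w - v * (norm w)\<^sup>2 / 2)"

lemma gauss_tilt_pos [simp]: "0 < gauss_tilt v w z" by (simp add: gauss_tilt_def)

lemma gauss_tilt_nonneg [simp]: "0 \<le> gauss_tilt v w z" by (simp add: gauss_tilt_def)

lemma gauss_tilt_nonzero [simp]: "gauss_tilt v w z \<noteq> 0" by (simp add: gauss_tilt_def)

lemma gauss_tilt_measurable [measurable (raw)]:
  assumes [measurable]: "f \<in> borel_measurable N" "g \<in> borel_measurable N"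
  shows "(\<lambda>x. gauss_tilt v (f x) (g x)) \<in> borel_measurable N"
  unfolding gauss_tilt_def by measurable

text \<open>The entropy estimates draw on the noise law through its moment generating function
  alone: every moment below reduces to the integral of a single tilt, which is 1.\<close>

locale gauss_mgf = prob_space P
  for P :: "'a::euclidean_space measure" +
  fixes v :: real
  assumes sets_P: "sets P = sets borel"
    and variance_nonneg: "0 \<le> v"
    and mgf_integrable: "\<And>w. integrable P (\<lambda>z. exp (z \<bullet> w))"
    and mgf: "\<And>w. (\<integral>z. exp (z \<bullet> w) \<partial>P) = exp (v * (norm w)\<^sup>2 / 2)"
begin

lemma measurable_P [measurable_cong]: "sets P = sets borel" by (fact sets_P)

abbreviation tilt :: "'a \<Rightarrow> 'a \<Rightarrow> real"
  where "tilt \<equiv> gauss_tilt v"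

lemma integrable_tilt [simp, intro]: "integrable P (tilt w)"
  using mgf_integrable[of w] by (simp add: gauss_tilt_def[abs_def] exp_diff)

lemma integral_tilt [simp]: "integral\<^sup>L P (tilt w) = 1"
  using mgf[of w] by (simp add: gauss_tilt_def[abs_def] exp_diff)

text \<open>Completing the square. This closure under products makes every mixed moment of tilts
  explicit: each pair of factors contributes one inner product to the exponent.\<close>

lemma tilt_mult: "tilt a z * tilt b z = exp (v * (a \<bullet> b)) * tilt (a + b) z"
  by (simp add: gauss_tilt_def inner_add_right power2_norm_eq_inner inner_add_left inner_commute
      flip: exp_add) (simp add: field_simps)

lemma tilt_mult3:
  "tilt a z * tilt b z * tilt c z = exp (v * (a \<bullet> b + a \<bullet> c + b \<bullet> c)) * tilt (a + b + c) z"
  by (simp add: tilt_mult mult.assoc) (simp add: tilt_mult inner_add_left algebra_simps flip: exp_add)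

lemma integrable_tilt_mult [simp, intro]: "integrable P (\<lambda>z. tilt a z * tilt b z)"
  by (simp add: tilt_mult)

lemma integrable_tilt_mult3 [simp, intro]: "integrable P (\<lambda>z. tilt a z * tilt b z * tilt c z)"
  by (simp add: tilt_mult3)

lemma integral_tilt_mult: "(\<integral>z. tilt a z * tilt b z \<partial>P) = exp (v * (a \<bullet> b))"
  by (simp add: tilt_mult)

lemma integral_tilt_mult3:
  "(\<integral>z. tilt a z * tilt b z * tilt c z \<partial>P) = exp (v * (a \<bullet> b + a \<bullet> c + b \<bullet> c))"
  by (simp add: tilt_mult3)

lemma tilt_power4: "tilt a z ^ 4 = exp (6 * (v * (a \<bullet> a))) * tilt (4 *\<^sub>R a) z"
  by (simp add: gauss_tilt_def power2_norm_eq_inner flip: exp_add exp_of_nat_mult)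

lemma integral_tilt_minus_1_pow2:
  "integrable P (\<lambda>z. (tilt a z - 1) * (tilt b z - 1))"
  "(\<integral>z. (tilt a z - 1) * (tilt b z - 1) \<partial>P) = exp (v * (a \<bullet> b)) - 1"
  by (simp_all add: algebra_simps integral_tilt_mult prob_space)

text \<open>In the value, both the constants and the terms linear in the inner products cancel, so
  it is of second order in them.\<close>

lemma integral_tilt_minus_1_pow3:
  "integrable P (\<lambda>z. (tilt a z - 1) * (tilt b z - 1) * (tilt c z - 1))"
  "(\<integral>z. (tilt a z - 1) * (tilt b z - 1) * (tilt c z - 1) \<partial>P) =
    exp (v * (a \<bullet> b + a \<bullet> c + b \<bullet> c)) - exp (v * (a \<bullet> b)) - exp (v * (a \<bullet> c)) - exp (v * (b \<bullet> c)) + 2"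
proof -
  have eq: "(tilt a z - 1) * (tilt b z - 1) * (tilt c z - 1) =
    tilt a z * tilt b z * tilt c z - tilt a z * tilt b z - tilt a z * tilt c z - tilt b z * tilt c z
      + tilt a z + tilt b z + tilt c z - 1" for z
    by (simp add: algebra_simps)
  show "integrable P (\<lambda>z. (tilt a z - 1) * (tilt b z - 1) * (tilt c z - 1))"
    unfolding eq by (intro Bochner_Integration.integrable_diff Bochner_Integration.integrable_add) auto
  show "(\<integral>z. (tilt a z - 1) * (tilt b z - 1) * (tilt c z - 1) \<partial>P) =
    exp (v * (a \<bullet> b + a \<bullet> c + b \<bullet> c)) - exp (v * (a \<bullet> b)) - exp (v * (a \<bullet> c)) - exp (v * (b \<bullet> c)) + 2"
    unfolding eq by (simp add: integral_tilt_mult integral_tilt_mult3 prob_space)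
qed

text \<open>The factors 6, 3 and 1 in the exponents count the pairs among four, three and two equal
  tilts. Constants (1 - 4 + 6 - 3) and linear terms (6 - 12 + 6) cancel, so only second order
  remains.\<close>

lemma integral_tilt_minus_1_pow4:
  "integrable P (\<lambda>z. (tilt a z - 1) ^ 4)"
  "(\<integral>z. (tilt a z - 1) ^ 4 \<partial>P) =
    exp (6 * (v * (a \<bullet> a))) - 4 * exp (3 * (v * (a \<bullet> a))) + 6 * exp (v * (a \<bullet> a)) - 3"
proof -
  have eq: "(tilt a z - 1) ^ 4 =
    exp (6 * (v * (a \<bullet> a))) * tilt (4 *\<^sub>R a) z - 4 * (tilt a z * tilt a z * tilt a z)
      + 6 * (tilt a z * tilt a z) - 4 * tilt a z + 1" for z
    unfolding tilt_power4[symmetric] by (simp add: algebra_simps power4_eq_xxxx)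
  show "integrable P (\<lambda>z. (tilt a z - 1) ^ 4)"
    unfolding eq by (intro Bochner_Integration.integrable_diff Bochner_Integration.integrable_add) auto
  show "(\<integral>z. (tilt a z - 1) ^ 4 \<partial>P) =
    exp (6 * (v * (a \<bullet> a))) - 4 * exp (3 * (v * (a \<bullet> a))) + 6 * exp (v * (a \<bullet> a)) - 3"
    unfolding eq by (simp add: integral_tilt_mult integral_tilt_mult3 prob_space distrib_left)
qed


text \<open>The exact value would be the mean v (norm w)^2 of z . w under the tilted law. A multiple
  of d suffices for the large regime, and it follows from the moment generating function by z . w
  \<le> T (exp (z . w / T) - 1), without differentiating under the integral.\<close>

lemma integral_tilt_mult_inner_le:
  assumes "v * (norm w)\<^sup>2 \<le> d" "1 / 6 < d"
  shows "integrable P (\<lambda>z. tilt w z * (z \<bullet> w))"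
    and "(\<integral>z. tilt w z * (z \<bullet> w) \<partial>P) \<le> 3 * d"
proof -
  \<comment> \<open>With T = 6 d > 1 the resulting exponent is at most 1/6 + 1/(12 T) \<le> 1/4, and
    exp (1/4) \<le> 3/2 turns the bound into T / 2 = 3 d.\<close>
  define T where "T = 6 * d"
  have T: "1 < T" using assms by (simp add: T_def)
  have exp_eq: "tilt w z * exp (c * (z \<bullet> w)) = exp (v * (norm w)\<^sup>2 * (c + c\<^sup>2 / 2)) * tilt ((1 + c) *\<^sub>R w) z"
    for c z
    by (simp add: gauss_tilt_def power_mult_distrib flip: exp_add)
      (simp add: algebra_simps power2_eq_square)
  have int_exp: "integrable P (\<lambda>z. tilt w z * exp (c * (z \<bullet> w)))" for c
    by (simp add: exp_eq)
  show int: "integrable P (\<lambda>z. tilt w z * (z \<bullet> w))"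
  proof (rule Bochner_Integration.integrable_bound)
    show "integrable P (\<lambda>z. tilt w z * exp (1 * (z \<bullet> w)) + tilt w z * exp ((-1) * (z \<bullet> w)))"
      by (intro Bochner_Integration.integrable_add int_exp)
    show "AE z in P. norm (tilt w z * (z \<bullet> w))
        \<le> norm (tilt w z * exp (1 * (z \<bullet> w)) + tilt w z * exp ((-1) * (z \<bullet> w)))"
    proof (rule AE_I2)
      fix z
      have "\<bar>z \<bullet> w\<bar> \<le> exp (z \<bullet> w) + exp (- (z \<bullet> w))"
        using exp_ge_add_one_self[of "z \<bullet> w"] exp_ge_add_one_self[of "- (z \<bullet> w)"]
          exp_gt_zero[of "z \<bullet> w"] exp_gt_zero[of "- (z \<bullet> w)"] by linarith
      then have "tilt w z * \<bar>z \<bullet> w\<bar> \<le> tilt w z * (exp (z \<bullet> w) + exp (- (z \<bullet> w)))"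
        by (intro mult_left_mono) (auto intro: less_imp_le)
      then show "norm (tilt w z * (z \<bullet> w))
          \<le> norm (tilt w z * exp (1 * (z \<bullet> w)) + tilt w z * exp ((-1) * (z \<bullet> w)))"
        by (simp add: abs_mult distrib_left)
    qed
  qed simp
  have "(\<integral>z. tilt w z * (z \<bullet> w) \<partial>P) \<le> (\<integral>z. T * (tilt w z * exp ((1 / T) * (z \<bullet> w))) - T * tilt w z \<partial>P)"
  proof (rule integral_mono[OF int])
    show "integrable P (\<lambda>z. T * (tilt w z * exp ((1 / T) * (z \<bullet> w))) - T * tilt w z)"
      by (intro Bochner_Integration.integrable_diff integrable_mult_right int_exp) auto
    fix z
    have "z \<bullet> w \<le> T * exp ((1 / T) * (z \<bullet> w)) - T"
      using mult_left_mono[OF exp_ge_add_one_self[of "(1 / T) * (z \<bullet> w)"], of T] T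
      by (simp add: distrib_left)
    then show "tilt w z * (z \<bullet> w) \<le> T * (tilt w z * exp ((1 / T) * (z \<bullet> w))) - T * tilt w z"
      using mult_left_mono[of "z \<bullet> w" "T * exp ((1 / T) * (z \<bullet> w)) - T" "tilt w z"]
      by (simp add: right_diff_distrib mult.left_commute mult.commute[of _ T])
  qed
  also have "\<dots> = T * exp (v * (norm w)\<^sup>2 * (1 / T + (1 / T)\<^sup>2 / 2)) - T"
    by (simp only: exp_eq) simp
  also have "\<dots> \<le> T * (1 + 1 / 2) - T"
  proof -
    have "v * (norm w)\<^sup>2 * (1 / T + (1 / T)\<^sup>2 / 2) \<le> d * (1 / T + (1 / T)\<^sup>2 / 2)"
      using assms T by (intro mult_right_mono) auto
    also have "\<dots> = 1 / 6 + 1 / (12 * T)"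
      using assms by (simp add: T_def power2_eq_square field_simps)
    also have "\<dots> \<le> 1 / 4"
      using T by (simp add: field_simps)
    finally have *: "exp (v * (norm w)\<^sup>2 * (1 / T + (1 / T)\<^sup>2 / 2)) \<le> exp (1 / 4)"
      by simp
    also have "\<dots> \<le> 1 + 1 / 2"
      using exp_bound[of "1 / 4"] by (simp add: power2_eq_square)
    finally show ?thesis using T by (intro diff_right_mono mult_left_mono) auto
  qed
  finally show "(\<integral>z. tilt w z * (z \<bullet> w) \<partial>P) \<le> 3 * d"
    by (simp add: T_def)
qed

text \<open>The logarithm of a tilt is affine in z . w; d is any number above both v (norm w)^2 and
  1/6.\<close>

lemma integrable_tilt_mult_ln: "integrable P (\<lambda>z. tilt w z * ln (tilt w z))"
proof -
  obtain d where "v * (norm w)\<^sup>2 \<le> d" "1 / 6 < d"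
    by (metis linorder_not_less less_eq_real_def gt_ex max.strict_boundedE)
  from integral_tilt_mult_inner_le(1)[OF this] show ?thesis
    by (simp add: gauss_tilt_def[of v w, THEN arg_cong[of _ _ ln]] right_diff_distrib)
qed

section \<open>Entropy of a finite mixture of tilts\<close>

context
  fixes J :: "'i set" and q :: "'i \<Rightarrow> real" and w :: "'i \<Rightarrow> 'a" and d :: real
  assumes fin: "finite J" and q_nonneg: "\<And>j. j \<in> J \<Longrightarrow> 0 \<le> q j" and q_sum: "sum q J = 1"
    and small: "\<And>j. j \<in> J \<Longrightarrow> v * (norm (w j))\<^sup>2 \<le> d"
begin

lemma mixture_tilt_pos: "0 < (\<Sum>j\<in>J. q j * tilt (w j) z)"
proof -
  obtain j where "j \<in> J" "q j \<noteq> 0"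
    using q_sum by (metis sum.neutral zero_neq_one)
  then show ?thesis
    using fin q_nonneg by (intro sum_pos2[of J j]) (auto simp: less_le)
qed

text \<open>The integrand is squeezed between L - 1 (tangent at 1) and the average of the component
  integrands (Jensen). This gives integrability, and integrating the two bounds gives the sign, as L
  has mean 1, and the upper estimate.\<close>

lemma
  shows mixture_mult_ln_integrable:
      "integrable P (\<lambda>z. (\<Sum>j\<in>J. q j * tilt (w j) z) * ln (\<Sum>j\<in>J. q j * tilt (w j) z))"
    and mixture_mult_ln_nonneg:
      "0 \<le> (\<integral>z. (\<Sum>j\<in>J. q j * tilt (w j) z) * ln (\<Sum>j\<in>J. q j * tilt (w j) z) \<partial>P)"
    and mixture_mult_ln_le:
      "(\<integral>z. (\<Sum>j\<in>J. q j * tilt (w j) z) * ln (\<Sum>j\<in>J. q j * tilt (w j) z) \<partial>P)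
        \<le> (\<Sum>j\<in>J. q j * (\<integral>z. tilt (w j) z * ln (tilt (w j) z) \<partial>P))"
proof -
  define L where "L = (\<lambda>z. \<Sum>j\<in>J. q j * tilt (w j) z)"
  define U where "U = (\<lambda>z. \<Sum>j\<in>J. q j * (tilt (w j) z * ln (tilt (w j) z)))"
  have L_pos: "0 < L z" for z using mixture_tilt_pos by (simp add: L_def)
  have L_meas [measurable]: "L \<in> borel_measurable borel" unfolding L_def by measurable
  have intL: "integrable P L" unfolding L_def by (intro Bochner_Integration.integrable_sum) auto
  have int1: "integral\<^sup>L P L = 1"
    unfolding L_def by (subst Bochner_Integration.integral_sum) (auto simp: q_sum)
  have intU: "integrable P U"
    unfolding U_def by (intro Bochner_Integration.integrable_sum integrable_mult_right integrable_tilt_mult_ln)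
  have lower: "L z - 1 \<le> L z * ln (L z)" for z
    using mult_ln_tangent[of "L z" 1] L_pos[of z] by simp
  have upper: "L z * ln (L z) \<le> U z" for z
    using mult_ln_sum_le[of J q "\<lambda>j. tilt (w j) z"] fin q_nonneg q_sum L_pos[of z]
    by (simp add: L_def U_def)
  have int: "integrable P (\<lambda>z. L z * ln (L z))"
  proof (rule Bochner_Integration.integrable_bound)
    show "integrable P (\<lambda>z. \<bar>L z - 1\<bar> + \<bar>U z\<bar>)"
      using intL intU by auto
    show "AE z in P. norm (L z * ln (L z)) \<le> norm (\<bar>L z - 1\<bar> + \<bar>U z\<bar>)"
    proof (rule AE_I2)
      fix z
      show "norm (L z * ln (L z)) \<le> norm (\<bar>L z - 1\<bar> + \<bar>U z\<bar>)"
        using lower[of z] upper[of z] unfolding real_norm_def by linarith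
    qed
  qed measurable
  then show "integrable P (\<lambda>z. (\<Sum>j\<in>J. q j * tilt (w j) z) * ln (\<Sum>j\<in>J. q j * tilt (w j) z))"
    by (simp add: L_def)
  have "0 = (\<integral>z. L z - 1 \<partial>P)" using intL int1 by (simp add: prob_space)
  also have "\<dots> \<le> (\<integral>z. L z * ln (L z) \<partial>P)"
    using intL int lower by (intro integral_mono) auto
  finally show "0 \<le> (\<integral>z. (\<Sum>j\<in>J. q j * tilt (w j) z) * ln (\<Sum>j\<in>J. q j * tilt (w j) z) \<partial>P)"
    by (simp add: L_def)
  have "(\<integral>z. L z * ln (L z) \<partial>P) \<le> integral\<^sup>L P U"
    using intU int upper by (intro integral_mono) auto
  also have "\<dots> = (\<Sum>j\<in>J. q j * (\<integral>z. tilt (w j) z * ln (tilt (w j) z) \<partial>P))"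
    unfolding U_def using integrable_tilt_mult_ln by simp
  finally show "(\<integral>z. (\<Sum>j\<in>J. q j * tilt (w j) z) * ln (\<Sum>j\<in>J. q j * tilt (w j) z) \<partial>P)
        \<le> (\<Sum>j\<in>J. q j * (\<integral>z. tilt (w j) z * ln (tilt (w j) z) \<partial>P))"
    by (simp add: L_def)
qed

lemma weighted_sum_le:
  assumes "\<And>j. j \<in> J \<Longrightarrow> \<bar>f j\<bar> \<le> B"
  shows "\<bar>\<Sum>j\<in>J. q j * f j\<bar> \<le> (B::real)"
proof -
  have "\<bar>\<Sum>j\<in>J. q j * f j\<bar> \<le> (\<Sum>j\<in>J. q j * B)"
    using assms q_nonneg by (intro order_trans[OF sum_abs sum_mono]) (auto simp: abs_mult intro!: mult_left_mono)
  then show ?thesis using q_sum by (simp flip: sum_distrib_right)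
qed

lemma inner_le: "i \<in> J \<Longrightarrow> j \<in> J \<Longrightarrow> \<bar>v * (w i \<bullet> w j)\<bar> \<le> d"
proof -
  assume ij: "i \<in> J" "j \<in> J"
  have "\<bar>w i \<bullet> w j\<bar> \<le> ((norm (w i))\<^sup>2 + (norm (w j))\<^sup>2) / 2"
    using Cauchy_Schwarz_ineq2[of "w i" "w j"] sum_squares_bound[of "norm (w i)" "norm (w j)"] by simp
  then have "v * \<bar>w i \<bullet> w j\<bar> \<le> v * (((norm (w i))\<^sup>2 + (norm (w j))\<^sup>2) / 2)"
    using variance_nonneg by (intro mult_left_mono)
  also have "\<dots> \<le> d"
    using small[OF ij(1)] small[OF ij(2)] by (simp add: field_simps)
  finally show ?thesis using variance_nonneg by (simp add: abs_mult)
qed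

text \<open>Brings the leading term into the shape of the double average to which the second moment
  of the mixture reduces.\<close>

lemma norm_weighted_sum:
  "v * (norm (\<Sum>j\<in>J. q j *\<^sub>R w j))\<^sup>2 = (\<Sum>i\<in>J. q i * (\<Sum>j\<in>J. q j * (v * (w i \<bullet> w j))))"
proof -
  have "v * (norm (\<Sum>j\<in>J. q j *\<^sub>R w j))\<^sup>2
      = v * (\<Sum>i\<in>J. q i * (w i \<bullet> (\<Sum>j\<in>J. q j *\<^sub>R w j)))"
    by (simp only: power2_norm_eq_inner inner_sum_left inner_scaleR_left)
  then show ?thesis
    by (simp add: inner_sum_right sum_distrib_left algebra_simps)
qed

lemma norm_weighted_sum_le: "v * (norm (\<Sum>j\<in>J. q j *\<^sub>R w j))\<^sup>2 \<le> d"
proof -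
  have "\<bar>\<Sum>i\<in>J. q i * (\<Sum>j\<in>J. q j * (v * (w i \<bullet> w j)))\<bar> \<le> d"
    by (intro weighted_sum_le inner_le)
  then show ?thesis by (simp add: norm_weighted_sum)
qed

text \<open>No cancellation is exploited here: the entropy lies in [0, 3 d], the quadratic form in
  [0, d], and d \<le> 6 d^2 once d exceeds 1/6.\<close>

lemma mixture_mult_ln_large:
  assumes "1 / 6 < d"
  shows "\<bar>(\<integral>z. (\<Sum>j\<in>J. q j * tilt (w j) z) * ln (\<Sum>j\<in>J. q j * tilt (w j) z) \<partial>P)
    - v * (norm (\<Sum>j\<in>J. q j *\<^sub>R w j))\<^sup>2 / 2\<bar> \<le> 30 * d\<^sup>2"
proof -
  let ?D = "\<integral>z. (\<Sum>j\<in>J. q j * tilt (w j) z) * ln (\<Sum>j\<in>J. q j * tilt (w j) z) \<partial>P"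
  have "(\<integral>z. tilt (w j) z * ln (tilt (w j) z) \<partial>P) \<le> 3 * d" if "j \<in> J" for j
  proof -
    have "(\<integral>z. tilt (w j) z * ln (tilt (w j) z) \<partial>P) =
        (\<integral>z. tilt (w j) z * (z \<bullet> w j) - (v * (norm (w j))\<^sup>2 / 2) * tilt (w j) z \<partial>P)"
      by (intro Bochner_Integration.integral_cong) (auto simp: gauss_tilt_def algebra_simps)
    also have "\<dots> = (\<integral>z. tilt (w j) z * (z \<bullet> w j) \<partial>P) - v * (norm (w j))\<^sup>2 / 2"
      using integral_tilt_mult_inner_le(1)[OF small[OF that] assms] by simp
    also have "\<dots> \<le> 3 * d"
      using integral_tilt_mult_inner_le(2)[OF small[OF that] assms] variance_nonneg
        mult_nonneg_nonneg[of v "(norm (w j))\<^sup>2"] zero_le_power2[of "norm (w j)"] by linarith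
    finally show ?thesis .
  qed
  then have "(\<Sum>j\<in>J. q j * (\<integral>z. tilt (w j) z * ln (tilt (w j) z) \<partial>P)) \<le> (\<Sum>j\<in>J. q j * (3 * d))"
    using q_nonneg by (intro sum_mono mult_left_mono) auto
  also have "\<dots> = 3 * d" using q_sum by (simp flip: sum_distrib_right)
  finally have "?D \<le> 3 * d" using mixture_mult_ln_le by linarith
  moreover have "0 \<le> v * (norm (\<Sum>j\<in>J. q j *\<^sub>R w j))\<^sup>2"
    using variance_nonneg by simp
  moreover have "d \<le> 6 * d\<^sup>2"
    using assms by (simp add: power2_eq_square)
  ultimately show ?thesis
    using mixture_mult_ln_nonneg norm_weighted_sum_le assms zero_le_power2[of d] by linarith
qed

text \<open>The bounds on t ln t are integrated at t = L. The first moment of L - 1 vanishes, the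
  second yields the quadratic form up to d^2, and the third and fourth are of order d^2 by
  cancellation. The threshold 1/6 keeps the largest exponent, 6 d, within the range of the bound on
  exp.\<close>

lemma mixture_mult_ln_small:
  assumes d: "d \<le> 1 / 6"
  shows "\<bar>(\<integral>z. (\<Sum>j\<in>J. q j * tilt (w j) z) * ln (\<Sum>j\<in>J. q j * tilt (w j) z) \<partial>P)
    - v * (norm (\<Sum>j\<in>J. q j *\<^sub>R w j))\<^sup>2 / 2\<bar> \<le> 30 * d\<^sup>2"
proof -
  define L where "L = (\<lambda>z. \<Sum>j\<in>J. q j * tilt (w j) z)"
  define f where "f = (\<lambda>j z. tilt (w j) z - 1)"
  \<comment> \<open>All moments are rewritten through this remainder, which makes the cancellation
    of constant and linear parts visible.\<close>
  define r where "r = (\<lambda>x::real. exp x - 1 - x)"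
  define b where "b = (\<lambda>i j. v * (w i \<bullet> w j))"
  have r: "\<bar>r x\<bar> \<le> c\<^sup>2 * d\<^sup>2" if "\<bar>x\<bar> \<le> c * d" "c * d \<le> 1" for x c
  proof -
    have "\<bar>r x\<bar> \<le> \<bar>x\<bar>\<^sup>2"
      using abs_exp_minus_affine_le[of x] that by (simp add: r_def)
    also have "\<dots> \<le> (c * d)\<^sup>2" using that by (intro power_mono) auto
    finally show ?thesis by (simp add: power_mult_distrib)
  qed
  have b: "\<bar>b i j\<bar> \<le> d" if "i \<in> J" "j \<in> J" for i j
    using inner_le that by (simp add: b_def)
  have s_eq: "L z - 1 = (\<Sum>j\<in>J. q j * f j z)" for z
    using q_sum by (simp add: L_def f_def right_diff_distrib sum_subtractf)
  have L_pos: "0 < L z" for z using mixture_tilt_pos by (simp add: L_def)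
  have intD: "integrable P (\<lambda>z. L z * ln (L z))"
    using mixture_mult_ln_integrable by (simp add: L_def)
  have int1: "integrable P (\<lambda>z. L z - 1)" and s1: "(\<integral>z. L z - 1 \<partial>P) = 0"
    unfolding s_eq f_def by (auto simp: prob_space)
  have pow2: "(L z - 1)\<^sup>2 = (\<Sum>i\<in>J. q i * (\<Sum>j\<in>J. q j * (f i z * f j z)))" for z
    unfolding s_eq by (simp add: power2_eq_square sum_product sum_distrib_left algebra_simps)
  have i2: "integrable P (\<lambda>z. f i z * f j z)" for i j
    unfolding f_def by (rule integral_tilt_minus_1_pow2)
  have int2: "integrable P (\<lambda>z. (L z - 1)\<^sup>2)"
    unfolding pow2 by (intro Bochner_Integration.integrable_sum integrable_mult_right i2)
  have "(\<integral>z. (L z - 1)\<^sup>2 \<partial>P) = (\<Sum>i\<in>J. q i * (\<Sum>j\<in>J. q j * (r (b i j) + b i j)))"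
    unfolding pow2 by (simp add: i2) (simp add: f_def integral_tilt_minus_1_pow2 r_def b_def)
  then have "(\<integral>z. (L z - 1)\<^sup>2 \<partial>P) - v * (norm (\<Sum>j\<in>J. q j *\<^sub>R w j))\<^sup>2
      = (\<Sum>i\<in>J. q i * (\<Sum>j\<in>J. q j * r (b i j)))"
    by (simp add: norm_weighted_sum b_def distrib_left sum.distrib)
  also have "\<bar>\<dots>\<bar> \<le> d\<^sup>2"
    using r[of _ 1] b d by (intro weighted_sum_le) auto
  finally have s2: "\<bar>(\<integral>z. (L z - 1)\<^sup>2 \<partial>P) - v * (norm (\<Sum>j\<in>J. q j *\<^sub>R w j))\<^sup>2\<bar> \<le> d\<^sup>2" .
  have pow3: "(L z - 1) ^ 3 = (\<Sum>i\<in>J. q i * (\<Sum>j\<in>J. q j * (\<Sum>k\<in>J. q k * (f i z * f j z * f k z))))" for z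
    unfolding s_eq by (simp add: power3_eq_cube sum_product sum_distrib_left sum_distrib_right algebra_simps)
  have i3: "integrable P (\<lambda>z. f i z * f j z * f k z)" for i j k
    unfolding f_def by (rule integral_tilt_minus_1_pow3)
  have int3: "integrable P (\<lambda>z. (L z - 1) ^ 3)"
    unfolding pow3 by (intro Bochner_Integration.integrable_sum integrable_mult_right i3)
  have e3: "(\<integral>z. f i z * f j z * f k z \<partial>P)
      = r (b i j + b i k + b j k) - r (b i j) - r (b i k) - r (b j k)" for i j k
    by (simp add: f_def integral_tilt_minus_1_pow3(2) r_def b_def distrib_left)
  have "(\<integral>z. (L z - 1) ^ 3 \<partial>P) = (\<Sum>i\<in>J. q i * (\<Sum>j\<in>J. q j * (\<Sum>k\<in>J. q k *
      (r (b i j + b i k + b j k) - r (b i j) - r (b i k) - r (b j k)))))"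
    unfolding pow3 by (simp add: i3 e3)
  also have "\<bar>\<dots>\<bar> \<le> 12 * d\<^sup>2"
  proof (intro weighted_sum_le)
    fix i j k assume ijk: "i \<in> J" "j \<in> J" "k \<in> J"
    have "\<bar>b i j + b i k + b j k\<bar> \<le> 3 * d"
      using b[of i j] b[of i k] b[of j k] ijk by linarith
    then have "\<bar>r (b i j + b i k + b j k)\<bar> \<le> 9 * d\<^sup>2" using d r[of _ 3] by simp
    moreover have "\<bar>r (b i j)\<bar> \<le> d\<^sup>2" "\<bar>r (b i k)\<bar> \<le> d\<^sup>2" "\<bar>r (b j k)\<bar> \<le> d\<^sup>2"
      using r[of _ 1] b ijk d by auto
    ultimately show "\<bar>r (b i j + b i k + b j k) - r (b i j) - r (b i k) - r (b j k)\<bar> \<le> 12 * d\<^sup>2"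
      by linarith
  qed
  finally have s3: "\<bar>\<integral>z. (L z - 1) ^ 3 \<partial>P\<bar> \<le> 12 * d\<^sup>2" .
  \<comment> \<open>The quartic term needs only an upper bound, so Jensen's inequality replaces a
    fourfold sum by the fourth moments of the single components.\<close>
  define V where "V = (\<lambda>z. \<Sum>j\<in>J. q j * f j z ^ 4)"
  have pow4: "(L z - 1) ^ 4 \<le> V z" for z
    unfolding s_eq V_def using fin q_nonneg q_sum by (intro power4_sum_le)
  have i4: "integrable P (\<lambda>z. f j z ^ 4)" for j
    unfolding f_def by (rule integral_tilt_minus_1_pow4)
  have int4: "integrable P V"
    unfolding V_def by (intro Bochner_Integration.integrable_sum integrable_mult_right i4)
  have e4: "(\<integral>z. f j z ^ 4 \<partial>P) = r (6 * b j j) - 4 * r (3 * b j j) + 6 * r (b j j)" for j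
    by (simp add: f_def integral_tilt_minus_1_pow4(2) r_def b_def)
  have "integral\<^sup>L P V = (\<Sum>j\<in>J. q j * (r (6 * b j j) - 4 * r (3 * b j j) + 6 * r (b j j)))"
    unfolding V_def by (simp add: i4 e4)
  also have "\<bar>\<dots>\<bar> \<le> 78 * d\<^sup>2"
  proof (intro weighted_sum_le)
    fix j assume j: "j \<in> J"
    \<comment> \<open>The total is 36 + 4 * 9 + 6 = 78.\<close>
    have "\<bar>r (6 * b j j)\<bar> \<le> 36 * d\<^sup>2" "\<bar>r (3 * b j j)\<bar> \<le> 9 * d\<^sup>2" "\<bar>r (b j j)\<bar> \<le> d\<^sup>2"
      using b[OF j j] d r[of "6 * b j j" 6] r[of "3 * b j j" 3] r[of "b j j" 1] by auto
    then show "\<bar>r (6 * b j j) - 4 * r (3 * b j j) + 6 * r (b j j)\<bar> \<le> 78 * d\<^sup>2"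
      by simp
  qed
  finally have s4: "\<bar>integral\<^sup>L P V\<bar> \<le> 78 * d\<^sup>2" .
  have "(\<integral>z. L z * ln (L z) \<partial>P) \<le> (\<integral>z. (L z - 1) + (L z - 1)\<^sup>2 / 2 - (L z - 1) ^ 3 / 6 + V z / 3 \<partial>P)"
  proof (rule integral_mono[OF intD])
    fix z
    show "L z * ln (L z) \<le> (L z - 1) + (L z - 1)\<^sup>2 / 2 - (L z - 1) ^ 3 / 6 + V z / 3"
      using mult_ln_le_quartic[OF L_pos[of z]] pow4[of z] by linarith
  qed (use int1 int2 int3 int4 in auto)
  also have "\<dots> = (\<integral>z. (L z - 1)\<^sup>2 \<partial>P) / 2 - (\<integral>z. (L z - 1) ^ 3 \<partial>P) / 6 + integral\<^sup>L P V / 3"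
    using int1 int2 int3 int4 s1 by simp
  finally have upper: "(\<integral>z. L z * ln (L z) \<partial>P) \<le> \<dots>" .
  have "(\<integral>z. (L z - 1)\<^sup>2 \<partial>P) / 2 - (\<integral>z. (L z - 1) ^ 3 \<partial>P) / 6
      = (\<integral>z. (L z - 1) + (L z - 1)\<^sup>2 / 2 - (L z - 1) ^ 3 / 6 \<partial>P)"
    using int1 int2 int3 s1 by simp
  also have "\<dots> \<le> (\<integral>z. L z * ln (L z) \<partial>P)"
    using mult_ln_ge_cubic[OF L_pos] by (intro integral_mono[OF _ intD]) (use int1 int2 int3 in auto)
  \<comment> \<open>The errors add up to 1/2 + 12/6 + 78/3 = 28.5 times d^2.\<close>
  finally have "\<bar>(\<integral>z. L z * ln (L z) \<partial>P) - v * (norm (\<Sum>j\<in>J. q j *\<^sub>R w j))\<^sup>2 / 2\<bar> \<le> 30 * d\<^sup>2"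
    using upper s2 s3 s4 by linarith
  then show ?thesis by (simp add: L_def)
qed

lemma mixture_mult_ln_expansion:
  "\<bar>(\<integral>z. (\<Sum>j\<in>J. q j * tilt (w j) z) * ln (\<Sum>j\<in>J. q j * tilt (w j) z) \<partial>P)
    - v * (norm (\<Sum>j\<in>J. q j *\<^sub>R w j))\<^sup>2 / 2\<bar> \<le> 30 * d\<^sup>2"
  using mixture_mult_ln_small mixture_mult_ln_large by linarith

end

end

section \<open>Gaussian vectors\<close>

definition gauss_density :: "real \<Rightarrow> 'a::euclidean_space \<Rightarrow> real"
  where "gauss_density \<sigma> z = (\<Prod>b\<in>Basis. normal_density 0 \<sigma> (z \<bullet> b))"

definition gauss :: "real \<Rightarrow> 'a::euclidean_space measure"
  where "gauss \<sigma> = density lborel (\<lambda>z. ennreal (gauss_density \<sigma> z))"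

lemma gauss_density_pos: "0 < \<sigma> \<Longrightarrow> 0 < gauss_density \<sigma> z"
  by (auto simp: gauss_density_def intro!: prod_pos normal_density_pos)

lemma gauss_density_nonneg [simp]: "0 \<le> gauss_density \<sigma> z"
  by (auto simp: gauss_density_def intro!: prod_nonneg)

lemma gauss_density_measurable [measurable]: "gauss_density \<sigma> \<in> borel_measurable borel"
  unfolding gauss_density_def by measurable

lemma sets_gauss [simp, measurable_cong]: "sets (gauss \<sigma>) = sets borel"
  by (simp add: gauss_def)

lemma space_gauss [simp]: "space (gauss \<sigma>) = UNIV"
  by (simp add: gauss_def)

lemma nn_integral_normal_density: "0 < \<sigma> \<Longrightarrow> (\<integral>\<^sup>+x. ennreal (normal_density \<mu> \<sigma> x) \<partial>lborel) = 1"
  by (subst nn_integral_eq_integral) auto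

lemma prob_space_gauss:
  assumes "0 < \<sigma>"
  shows "prob_space (gauss \<sigma> :: 'a::euclidean_space measure)"
proof
  have "(\<integral>\<^sup>+(z::'a). ennreal (gauss_density \<sigma> z) \<partial>lborel)
      = (\<integral>\<^sup>+(z::'a). (\<Prod>b\<in>Basis. ennreal (normal_density 0 \<sigma> (z \<bullet> b))) \<partial>lborel)"
    by (simp add: gauss_density_def prod_ennreal)
  also have "\<dots> = 1"
    using assms by (subst nn_integral_lborel_prod) (auto simp: nn_integral_normal_density)
  finally show "emeasure (gauss \<sigma> :: 'a measure) (space (gauss \<sigma>)) = 1"
    by (simp add: gauss_def emeasure_density)
qed

lemma gauss_density_diff:
  fixes a y :: "'a::euclidean_space"
  assumes "0 < \<sigma>"
  shows "gauss_density \<sigma> (y - a) = gauss_density \<sigma> y * gauss_tilt (\<sigma>\<^sup>2) (a /\<^sub>R \<sigma>\<^sup>2) y"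
proof -
  have eq: "gauss_density \<sigma> z = (\<Prod>b\<in>(Basis::'a set). 1 / sqrt (2 * pi * \<sigma>\<^sup>2)) * exp (- (z \<bullet> z) / (2 * \<sigma>\<^sup>2))"
    for z :: 'a
    by (simp add: gauss_density_def normal_density_def prod.distrib prod_dividef euclidean_inner[of z z]
        power2_eq_square sum_divide_distrib sum_negf power_divide flip: exp_sum)
  show ?thesis
    unfolding eq gauss_tilt_def mult.assoc exp_add[symmetric] power2_norm_eq_inner
    using assms by (simp add: inner_diff_left inner_diff_right inner_commute field_simps power2_eq_square)
qed

text \<open>The Cameron-Martin formula in finite dimension: translation invariance of Lebesgue
  measure moves the shift into the density, where it becomes a tilt.\<close>

lemma nn_integral_gauss_shift:
  fixes a :: "'a::euclidean_space"
  assumes "0 < \<sigma>" and [measurable]: "F \<in> borel_measurable borel"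
  shows "(\<integral>\<^sup>+z. F (a + z) \<partial>gauss \<sigma>) = (\<integral>\<^sup>+z. ennreal (gauss_tilt (\<sigma>\<^sup>2) (a /\<^sub>R \<sigma>\<^sup>2) z) * F z \<partial>gauss \<sigma>)"
proof -
  have "(\<integral>\<^sup>+z. F (a + z) \<partial>gauss \<sigma>) = (\<integral>\<^sup>+z. gauss_density \<sigma> ((a + z) - a) * F (a + z) \<partial>lborel)"
    by (simp add: gauss_def nn_integral_density)
  also have "\<dots> = (\<integral>\<^sup>+z. gauss_density \<sigma> (z - a) * F z \<partial>distr lborel borel ((+) a))"
    by (subst nn_integral_distr) auto
  also have "\<dots> = (\<integral>\<^sup>+z. ennreal (gauss_tilt (\<sigma>\<^sup>2) (a /\<^sub>R \<sigma>\<^sup>2) z) * F z \<partial>gauss \<sigma>)"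
    using assms(1) by (simp add: lborel_distr_plus gauss_def nn_integral_density gauss_density_diff ennreal_mult mult.assoc)
  finally show ?thesis .
qed

text \<open>The shift formula applied to the constant 1 says that each tilt integrates to 1, which
  is the moment generating function up to a factor; no Gaussian integral has to be computed.\<close>

lemma gauss_mgf_gauss:
  assumes "0 < \<sigma>"
  shows "gauss_mgf (gauss \<sigma> :: 'a::euclidean_space measure) (\<sigma>\<^sup>2)"
proof -
  interpret prob_space "gauss \<sigma> :: 'a measure" using assms by (rule prob_space_gauss)
  have tilt: "has_bochner_integral (gauss \<sigma>) (gauss_tilt (\<sigma>\<^sup>2) w) 1" for w :: 'a
  proof (rule has_bochner_integral_nn_integral)
    have "(\<integral>\<^sup>+z. ennreal (gauss_tilt (\<sigma>\<^sup>2) ((\<sigma>\<^sup>2 *\<^sub>R w) /\<^sub>R \<sigma>\<^sup>2) z) * 1 \<partial>gauss \<sigma>) = 1"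
      using nn_integral_gauss_shift[OF assms, of "\<lambda>_. 1" "\<sigma>\<^sup>2 *\<^sub>R w"] emeasure_space_1 by simp
    then show "(\<integral>\<^sup>+z. ennreal (gauss_tilt (\<sigma>\<^sup>2) w z) \<partial>gauss \<sigma>) = ennreal 1"
      using assms by simp
  qed auto
  have eq: "exp (z \<bullet> w) = exp (\<sigma>\<^sup>2 * (norm w)\<^sup>2 / 2) * gauss_tilt (\<sigma>\<^sup>2) w z" for w z :: 'a
    by (simp add: gauss_tilt_def flip: exp_add)
  show ?thesis
    by unfold_locales (use tilt in \<open>auto simp: eq has_bochner_integral_iff\<close>)
qed

lemma prod_Basis_vec:
  fixes f :: "real ^ 'n \<Rightarrow> 'b::comm_monoid_mult"
  shows "(\<Prod>b\<in>Basis. f b) = (\<Prod>j\<in>UNIV. f (axis j 1))"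
proof -
  have inj: "inj (\<lambda>j::'n. axis j (1::real))" by (auto simp: inj_on_def axis_eq_axis)
  have "(Basis :: (real ^ 'n) set) = range (\<lambda>j. axis j 1)" by (auto simp: Basis_vec_def)
  then show ?thesis using prod.reindex[OF inj, of f] by (simp add: o_def)
qed

text \<open>Open boxes form an intersection-stable generator, and on a box both measures factor over
  coordinates: one by independence, the other because density and indicator are products.\<close>

lemma (in prob_space) distr_eq_gauss:
  fixes Z :: "'a \<Rightarrow> real ^ 'n"
  assumes "0 < \<sigma>"
    and normal: "\<And>j. distributed M lborel (\<lambda>w. Z w $ j) (normal_density 0 \<sigma>)"
    and indep: "indep_vars (\<lambda>_. borel) (\<lambda>j w. Z w $ j) UNIV"
  shows "distr M borel Z = gauss \<sigma>"
proof (rule measure_eqI_generator_eq)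
  let ?E = "range (\<lambda>(a, b). box a b :: (real ^ 'n) set)"
  let ?A = "\<lambda>n::nat. box (- (real n *\<^sub>R One)) (real n *\<^sub>R One) :: (real ^ 'n) set"
  have comp [measurable]: "(\<lambda>w. Z w $ j) \<in> borel_measurable M" for j
    using distributed_measurable[OF normal[of j]] by simp
  have Z [measurable]: "Z \<in> borel_measurable M"
    by (subst borel_measurable_euclidean_space) (auto simp: Basis_vec_def inner_axis)
  show "Int_stable ?E" by (auto simp: Int_stable_def box_Int_box)
  show "?E \<subseteq> Pow UNIV" "sets (distr M borel Z) = sigma_sets UNIV ?E" "sets (gauss \<sigma>) = sigma_sets UNIV ?E"
    by (simp_all add: borel_eq_box)
  show "range ?A \<subseteq> ?E" "(\<Union>i. ?A i) = UNIV"
    unfolding UN_box_eq_UNIV by auto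
  show "emeasure (distr M borel Z) (?A i) \<noteq> \<infinity>" for i
    by (simp add: emeasure_distr)
  show "emeasure (distr M borel Z) B = emeasure (gauss \<sigma>) B" if "B \<in> ?E" for B
  proof -
    from that obtain l u where B: "B = box l u" by (elim rangeE) (simp split: prod.splits)
    let ?I = "\<lambda>j. {l $ j<..<u $ j}"
    have "emeasure (distr M borel Z) B = prob (\<Inter>j\<in>UNIV. (\<lambda>w. Z w $ j) -` ?I j \<inter> space M)"
      by (subst emeasure_distr)
        (auto simp: B emeasure_eq_measure mem_box_cart intro!: arg_cong[of _ _ prob])
    also have "\<dots> = (\<Prod>j\<in>UNIV. prob ((\<lambda>w. Z w $ j) -` ?I j \<inter> space M))"
      by (rule arg_cong[OF indep_varsD_finite[OF indep]]) auto
    also have "\<dots> = (\<Prod>j\<in>UNIV. \<integral>\<^sup>+x. ennreal (normal_density 0 \<sigma> x) * indicator (?I j) x \<partial>lborel)"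
      by (subst prod_ennreal[symmetric])
        (auto simp: emeasure_eq_measure[symmetric] distributed_emeasure[OF normal] intro!: prod.cong)
    also have "\<dots> = (\<Prod>b\<in>Basis. \<integral>\<^sup>+x. ennreal (normal_density 0 \<sigma> x) * indicator {l \<bullet> b<..<u \<bullet> b} x \<partial>lborel)"
      by (simp add: prod_Basis_vec inner_axis)
    also have "\<dots> = (\<integral>\<^sup>+z. (\<Prod>b\<in>Basis. ennreal (normal_density 0 \<sigma> (z \<bullet> b)) * indicator {l \<bullet> b<..<u \<bullet> b} (z \<bullet> b)) \<partial>lborel)"
      by (subst nn_integral_lborel_prod[symmetric]) auto
    also have "\<dots> = (\<integral>\<^sup>+z. ennreal (gauss_density \<sigma> z) * indicator B z \<partial>lborel)"
      by (intro nn_integral_cong)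
        (auto simp: gauss_density_def B prod.distrib prod_ennreal mem_box indicator_def prod_eq_1_iff
          intro!: prod.neutral)
    also have "\<dots> = emeasure (gauss \<sigma>) B"
      by (simp add: gauss_def emeasure_density B)
    finally show ?thesis .
  qed
qed

section \<open>Moments from a tail bound\<close>

text \<open>The square of W is dominated by the sum over n of (n + 1)^2 times the indicator of W >
  n, and the stretched exponential tail makes the expected sum converge.\<close>

lemma (in prob_space) integrable_power2_of_tail:
  fixes W :: "'a \<Rightarrow> real"
  assumes [measurable]: "W \<in> borel_measurable M" and nonneg: "\<And>w. 0 \<le> W w"
    and "0 < r" and tail: "\<forall>\<^sub>F d in at_top. prob {w \<in> space M. W w > d} \<le> exp (- (d powr r))"
  shows "integrable M (\<lambda>w. (W w)\<^sup>2)"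
proof -
  define g where "g = (\<lambda>n::nat. (real n + 1)\<^sup>2 * prob {w \<in> space M. W w > real n})"
  have "(\<lambda>n::nat. (real n + 1)\<^sup>2 * exp (- (real n powr r))) \<in> O(\<lambda>n. 1 / real n ^ 2)"
    using \<open>0 < r\<close> by real_asymp
  then have "summable (\<lambda>n::nat. (real n + 1)\<^sup>2 * exp (- (real n powr r)))"
    by (rule summable_comparison_test_bigo[rotated]) (simp add: inverse_power_summable power_one_over flip: inverse_eq_divide)
  moreover have "\<forall>\<^sub>F n in sequentially. norm (g n) \<le> (real n + 1)\<^sup>2 * exp (- (real n powr r))"
    using filterlim_real_sequentially tail unfolding filterlim_iff
    by (auto simp: g_def abs_mult elim!: eventually_mono intro!: mult_left_mono)
  ultimately have summable: "summable g"
    by (metis summable_comparison_test_ev)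
  have "(\<integral>\<^sup>+w. ennreal ((W w)\<^sup>2) \<partial>M)
      \<le> (\<integral>\<^sup>+w. (\<Sum>n. ennreal ((real n + 1)\<^sup>2) * indicator {w \<in> space M. W w > real n} w) \<partial>M)"
  proof (rule nn_integral_mono)
    fix w assume w: "w \<in> space M"
    show "ennreal ((W w)\<^sup>2) \<le> (\<Sum>n. ennreal ((real n + 1)\<^sup>2) * indicator {w \<in> space M. W w > real n} w)"
    proof (cases "W w = 0")
      case False
      \<comment> \<open>The integer with n < W \<le> n + 1. It exists only for positive W, hence the
        separate case W = 0.\<close>
      define n where "n = nat \<lceil>W w\<rceil> - 1"
      have n: "real n < W w" "W w \<le> real n + 1"
        using False nonneg[of w] unfolding n_def by linarith+
      have "(W w)\<^sup>2 \<le> (real n + 1)\<^sup>2" using n nonneg[of w] by (intro power_mono) auto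
      then have "ennreal ((W w)\<^sup>2) \<le> ennreal ((real n + 1)\<^sup>2) * indicator {w \<in> space M. W w > real n} w"
        using n w by (simp add: ennreal_leI)
      also have "\<dots> \<le> (\<Sum>n. ennreal ((real n + 1)\<^sup>2) * indicator {w \<in> space M. W w > real n} w)"
        (is "?t n \<le> suminf ?t")
        using sum_le_suminf[OF summableI, of "{n}" ?t] by (metis (mono_tags, lifting) finite.emptyI finite.insertI sum.empty sum.insert empty_iff add.right_neutral zero_le subset_UNIV)
      finally show ?thesis .
    qed simp
  qed
  also have "\<dots> = (\<Sum>n. ennreal (g n))"
    by (simp add: nn_integral_suminf nn_integral_cmult_indicator g_def ennreal_mult emeasure_eq_measure)
  also have "\<dots> < \<infinity>"
    using summable by (simp add: g_def suminf_ennreal2 ennreal_suminf_neq_top less_top)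
  finally show ?thesis
    by (intro integrableI_nonneg) auto
qed

section \<open>The channel\<close>

definition hadamard :: "real ^ 'n \<Rightarrow> real ^ 'n \<Rightarrow> real ^ 'n"
  where "hadamard a b = (\<chi> j. a $ j * b $ j)"

lemma hadamard_measurable [measurable (raw)]:
  assumes "f \<in> borel_measurable N" "g \<in> borel_measurable N"
  shows "(\<lambda>x. hadamard (f x) (g x)) \<in> borel_measurable N"
  by (rule borel_measurable_continuous_Pair[OF assms])
    (unfold hadamard_def, intro continuous_intros)

lemma vec_nth_measurable [measurable (raw)]:
  assumes "f \<in> borel_measurable N"
  shows "(\<lambda>x. (f x :: real ^ 'n) $ j) \<in> borel_measurable N"
  by (rule measurable_compose[OF assms borel_measurable_continuous_onI]) (intro continuous_intros)

lemma norm_hadamard_le: "norm (hadamard a b) \<le> norm a * norm b"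
proof (rule power2_le_imp_le)
  have "(norm (hadamard a b))\<^sup>2 = (\<Sum>j\<in>UNIV. (a $ j)\<^sup>2 * (b $ j)\<^sup>2)"
    by (simp add: norm_vec_def L2_set_def hadamard_def sum_nonneg power_mult_distrib)
  also have "\<dots> \<le> (\<Sum>j\<in>UNIV. (a $ j)\<^sup>2 * (norm b)\<^sup>2)"
    using component_le_norm_cart[of b]
    by (intro sum_mono mult_left_mono) (auto simp: abs_le_square_iff[symmetric])
  also have "\<dots> = (norm a * norm b)\<^sup>2"
    by (simp add: norm_vec_def[of a] L2_set_def sum_nonneg power_mult_distrib sum_distrib_right)
  finally show "(norm (hadamard a b))\<^sup>2 \<le> (norm a * norm b)\<^sup>2" .
qed simp

lemma hadamard_sum_right: "hadamard a (\<Sum>j\<in>J. q j *\<^sub>R b j) = (\<Sum>j\<in>J. q j *\<^sub>R hadamard a (b j))"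
  by (simp add: hadamard_def vec_eq_iff sum_distrib_left algebra_simps)

section \<open>Conditional laws of a finite index\<close>

text \<open>\<open>P(J = j | \<kappa> J = u)\<close> for a random index \<open>J\<close> in \<open>I\<close> with \<open>P(J = i) = a i\<close>; zero if \<open>P(\<kappa> J = u) = 0\<close>.\<close>

definition cond_weight :: "nat set \<Rightarrow> (nat \<Rightarrow> real) \<Rightarrow> (nat \<Rightarrow> nat) \<Rightarrow> nat \<Rightarrow> nat \<Rightarrow> real"
  where "cond_weight I a \<kappa> u j = (if \<kappa> j = u then a j / sum a {i \<in> I. \<kappa> i = u} else 0)"

lemma cond_weight_nonneg:
  assumes "\<And>i. i \<in> I \<Longrightarrow> 0 \<le> a i" "j \<in> I"
  shows "0 \<le> cond_weight I a \<kappa> u j"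
  using assms by (auto simp: cond_weight_def intro!: divide_nonneg_nonneg sum_nonneg)

lemma cond_weight_sum:
  assumes "finite I" "sum a {i \<in> I. \<kappa> i = u} \<noteq> 0"
  shows "(\<Sum>j\<in>I. cond_weight I a \<kappa> u j) = 1"
proof -
  have "(\<Sum>j\<in>I. cond_weight I a \<kappa> u j) = (\<Sum>j\<in>{j \<in> I. \<kappa> j = u}. a j / sum a {i \<in> I. \<kappa> i = u})"
    using assms(1) unfolding cond_weight_def by (simp only: sum.inter_filter)
  also have "\<dots> = 1"
    using assms(2) by (simp flip: sum_divide_distrib)
  finally show ?thesis .
qed

lemma sum_mult_cond_weight:
  assumes "finite I" "\<And>i. i \<in> I \<Longrightarrow> 0 \<le> a i" "j \<in> I"
  shows "(\<Sum>i\<in>I. a i * cond_weight I a \<kappa> (\<kappa> i) j) = a j"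
proof -
  let ?P = "sum a {i \<in> I. \<kappa> i = \<kappa> j}"
  have "(\<Sum>i\<in>I. a i * cond_weight I a \<kappa> (\<kappa> i) j) = (\<Sum>i\<in>I. if \<kappa> i = \<kappa> j then a i * (a j / ?P) else 0)"
    by (intro sum.cong) (auto simp: cond_weight_def)
  also have "\<dots> = ?P * (a j / ?P)"
    using assms(1) by (simp add: sum.inter_filter[symmetric] sum_distrib_right sum_divide_distrib)
  also have "\<dots> = a j"
  \<comment> \<open>In a class of total weight zero the division yields 0, which is also the value
    of a j, since the weights are nonnegative.\<close>
  proof (cases "?P = 0")
    case True
    then have "\<forall>i\<in>{i \<in> I. \<kappa> i = \<kappa> j}. a i = 0"
      using assms by (subst (asm) sum_nonneg_eq_0_iff) auto
    then show ?thesis using assms(3) by auto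
  qed simp
  finally show ?thesis .
qed

text \<open>Redrawing the index from its conditional law given its \<kappa>-value does not change
  the joint law of index and \<kappa>-value.\<close>

lemma sum_regroup_ennreal:
  fixes F :: "nat \<Rightarrow> nat \<Rightarrow> ennreal"
  assumes "finite I" and nonneg: "\<And>i. i \<in> I \<Longrightarrow> 0 \<le> a i"
  shows "(\<Sum>i\<in>I. ennreal (a i) * (\<Sum>j\<in>I. ennreal (cond_weight I a \<kappa> (\<kappa> i) j) * F j (\<kappa> i)))
    = (\<Sum>j\<in>I. ennreal (a j) * F j (\<kappa> j))"
proof -
  have "(\<Sum>i\<in>I. ennreal (a i) * (\<Sum>j\<in>I. ennreal (cond_weight I a \<kappa> (\<kappa> i) j) * F j (\<kappa> i)))
      = (\<Sum>i\<in>I. \<Sum>j\<in>I. ennreal (a i * cond_weight I a \<kappa> (\<kappa> i) j) * F j (\<kappa> j))"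
    using nonneg cond_weight_nonneg[OF nonneg]
    by (auto simp: sum_distrib_left ennreal_mult mult.assoc intro!: sum.cong) (auto simp: cond_weight_def)
  also have "\<dots> = (\<Sum>j\<in>I. (\<Sum>i\<in>I. ennreal (a i * cond_weight I a \<kappa> (\<kappa> i) j)) * F j (\<kappa> j))"
    by (subst sum.swap) (simp add: sum_distrib_right)
  also have "\<dots> = (\<Sum>j\<in>I. ennreal (a j) * F j (\<kappa> j))"
    using assms cond_weight_nonneg[OF nonneg]
    by (intro sum.cong refl arg_cong2[of _ _ _ _ "(*)"]) (simp_all add: sum_mult_cond_weight)
  finally show ?thesis .
qed

section \<open>The transmitted index\<close>

context fading_bicm
begin

text \<open>The index is read off from the bits, where the labeling makes it unique on
  \<open>space M\<close>; it carries bits and symbol at once.\<close>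

definition idx :: "'w \<Rightarrow> nat"
  where "idx w = (THE i. i < 2 ^ m \<and> (\<forall>k<m. C k w = c i k))"

lemma idx:
  assumes w: "w \<in> space M"
  shows "idx w < 2 ^ m" "k < m \<Longrightarrow> C k w = c (idx w) k" "X w = x (idx w)"
proof -
  let ?Q = "\<lambda>i. i < 2 ^ m \<and> (\<forall>k<m. C k w = c i k)"
  have "C k w \<in> {0, 1}" if "k < m" for k
  proof -
    have "C k \<in> measurable M (count_space {0, 1})"
      using bits_indep that by (auto simp: indep_vars_def)
    then show ?thesis using w by (auto dest: measurable_space)
  qed
  then have "restrict (\<lambda>k. C k w) {..<m} \<in> (\<lambda>i. restrict (c i) {..<m}) ` {..<2 ^ m}"
    using bij_betw_imp_surj_on[OF labeling] by auto
  then obtain i where "restrict (\<lambda>k. C k w) {..<m} = restrict (c i) {..<m}" "i \<in> {..<2 ^ m}"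
    by (rule imageE)
  then have i: "i < 2 ^ m" "restrict (c i) {..<m} = restrict (\<lambda>k. C k w) {..<m}"
    by simp_all
  have "?Q i" using i by (metis lessThan_iff restrict_apply')
  moreover have "j = i" if "?Q j" for j
  proof -
    have "restrict (c j) {..<m} = restrict (c i) {..<m}"
      using i(2) that by (auto simp: restrict_def fun_eq_iff)
    then show ?thesis
      using labeling i(1) that unfolding bij_betw_def inj_on_def by blast
  qed
  ultimately have "?Q (idx w)" unfolding idx_def by (rule theI)
  then show "idx w < 2 ^ m" "k < m \<Longrightarrow> C k w = c (idx w) k" "X w = x (idx w)"
    using symbol[OF w] by auto
qed

text \<open>By distinctness of the alphabet. This passes measurability of \<open>X\<close>, and its
  independence from fading and noise, on to the index.\<close>

lemma idx_eq_iff: "w \<in> space M \<Longrightarrow> i < 2 ^ m \<Longrightarrow> idx w = i \<longleftrightarrow> X w = x i"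
  using idx[of w] alphabet_distinct by (auto simp: inj_on_def)

lemma
  shows X_measurable [measurable]: "X \<in> borel_measurable M"
    and H_measurable [measurable]: "H \<in> borel_measurable M"
    and Z_measurable: "0 < N0 \<Longrightarrow> Z N0 \<in> borel_measurable M"
proof -
  have *: "[X, H, Z N0] ! i \<in> borel_measurable M" if "0 < N0" "i < 3" for N0 and i :: nat
    using input_fading_noise_indep[OF that(1)] that(2) by (auto simp: indep_vars_def)
  show "X \<in> borel_measurable M" using *[of 1 0] by simp
  show "H \<in> borel_measurable M" using *[of 1 1] by simp
  show "0 < N0 \<Longrightarrow> Z N0 \<in> borel_measurable M" using *[of N0 2] by simp
qed

lemma C_measurable: "k < m \<Longrightarrow> C k \<in> measurable M (count_space {0, 1})"
  using bits_indep by (auto simp: indep_vars_def)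

lemma idx_measurable [measurable]: "idx \<in> measurable M (count_space UNIV)"
proof (rule measurable_count_space_eq2_countable[THEN iffD2])
  show "idx \<in> space M \<rightarrow> UNIV \<and> (\<forall>a\<in>UNIV. idx -` {a} \<inter> space M \<in> sets M)"
  proof safe
    fix i :: nat
    show "idx -` {i} \<inter> space M \<in> sets M"
    proof (cases "i < 2 ^ m")
      case True
      then have "idx -` {i} \<inter> space M = X -` {x i} \<inter> space M"
        using idx_eq_iff by auto
      then show ?thesis by simp
    next
      case False
      then have "idx -` {i} \<inter> space M = {}" using idx(1) by auto
      then show ?thesis by simp
    qed
  qed simp
qed

lemma indicator_idx_measurable [measurable]:
  "(\<lambda>w. indicator A (idx w) :: ennreal) \<in> borel_measurable M"
  by (rule measurable_compose[OF idx_measurable]) simp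

definition symbol_prob :: "nat \<Rightarrow> real"
  where "symbol_prob i = prob {w \<in> space M. idx w = i}"

lemma symbol_prob_nonneg [simp]: "0 \<le> symbol_prob i"
  by (simp add: symbol_prob_def)

lemma nn_integral_idx:
  assumes [measurable]: "f \<in> borel_measurable M"
  shows "(\<integral>\<^sup>+w. f w \<partial>M) = (\<Sum>i<2 ^ m. \<integral>\<^sup>+w. indicator {i} (idx w) * f w \<partial>M)"
proof -
  have "f w = (\<Sum>i<2 ^ m. indicator {i} (idx w) * f w)" if "w \<in> space M" for w
    using idx(1)[OF that] by (simp add: indicator_def flip: sum_distrib_right)
  then have "(\<integral>\<^sup>+w. f w \<partial>M) = (\<integral>\<^sup>+w. (\<Sum>i<2 ^ m. indicator {i} (idx w) * f w) \<partial>M)"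
    by (rule nn_integral_cong)
  also have "\<dots> = (\<Sum>i<2 ^ m. \<integral>\<^sup>+w. indicator {i} (idx w) * f w \<partial>M)"
    by (intro nn_integral_sum borel_measurable_times_ennreal indicator_idx_measurable assms)
  finally show ?thesis .
qed

end

section \<open>Joint laws at a fixed noise level\<close>

locale fading_bicm_at = fading_bicm M m x c C X H PH Z
  for M :: "'w measure" and m :: nat and x :: "nat \<Rightarrow> real ^ 'n" and c :: "nat \<Rightarrow> nat \<Rightarrow> nat"
    and C :: "nat \<Rightarrow> 'w \<Rightarrow> nat" and X H :: "'w \<Rightarrow> real ^ 'n"
    and PH :: "real measure" and Z :: "real \<Rightarrow> 'w \<Rightarrow> real ^ 'n" +
  fixes N0 :: real
  assumes N0_pos: "0 < N0"
begin

definition "\<sigma> = sqrt (N0 / 2)"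

abbreviation "v \<equiv> \<sigma>\<^sup>2"

lemma sigma_pos [simp]: "0 < \<sigma>" using N0_pos by (simp add: \<sigma>_def)

lemma sigma_nonzero [simp]: "\<sigma> \<noteq> 0" using sigma_pos by linarith

lemma v_eq: "v = N0 / 2" using N0_pos by (simp add: \<sigma>_def)

abbreviation "\<gamma> \<equiv> gauss \<sigma> :: (real ^ 'n) measure"

abbreviation "Y \<equiv> channel_output H X (Z N0)"

lemma Y_eq: "Y w = hadamard (H w) (X w) + Z N0 w"
  by (simp add: channel_output_def hadamard_def)

lemma ZN_measurable [measurable]: "Z N0 \<in> borel_measurable M"
  using Z_measurable N0_pos by simp

lemma Y_measurable [measurable]: "Y \<in> borel_measurable M"
  unfolding Y_eq[abs_def] by measurable

sublocale gamma: gauss_mgf \<gamma> v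
  by (rule gauss_mgf_gauss) simp

lemma distr_H_Z: "distr M (borel \<Otimes>\<^sub>M borel) (\<lambda>w. (H w, Z N0 w)) = distr M borel H \<Otimes>\<^sub>M \<gamma>"
proof -
  have "indep_var borel ((\<lambda>g. g 1) \<circ> (\<lambda>w. restrict (\<lambda>i. ([X, H, Z N0] ! i) w) {1}))
      borel ((\<lambda>g. g 2) \<circ> (\<lambda>w. restrict (\<lambda>i. ([X, H, Z N0] ! i) w) {2}))"
    by (rule indep_var_compose[OF indep_var_restrict[OF input_fading_noise_indep[OF N0_pos]]]) auto
  then have "indep_var borel H borel (Z N0)" by (simp add: comp_def)
  moreover have "distr M borel (Z N0) = \<gamma>"
    using N0_pos noise_gaussian noise_components_indep by (intro distr_eq_gauss) (auto simp: \<sigma>_def)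
  ultimately show ?thesis by (simp add: indep_var_distribution_eq)
qed

text \<open>Mutual independence is grouped as the symbol against the pair of fading and noise, with
  restrictions to the index sets {0} and {1, 2} as random elements of product spaces. The indicator
  of the index is a function of the first group.\<close>

lemma nn_integral_idx_H_Z:
  assumes i: "i < 2 ^ m" and f [measurable]: "f \<in> borel_measurable (borel \<Otimes>\<^sub>M borel)"
  shows "(\<integral>\<^sup>+w. indicator {i} (idx w) * f (H w, Z N0 w) \<partial>M)
    = ennreal (symbol_prob i) * (\<integral>\<^sup>+w. (\<integral>\<^sup>+z. f (H w, z) \<partial>\<gamma>) \<partial>M)"
proof -
  let ?HZ = "distr M (borel \<Otimes>\<^sub>M borel) (\<lambda>w. (H w, Z N0 w))"
  define A where "A = (\<lambda>w. restrict (\<lambda>i. ([X, H, Z N0] ! i) w) {0::nat})"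
  define B where "B = (\<lambda>w. restrict (\<lambda>i. ([X, H, Z N0] ! i) w) {1::nat, 2})"
  define PA :: "(nat \<Rightarrow> real ^ 'n) measure" where "PA = PiM {0::nat} (\<lambda>_. borel)"
  define PB :: "(nat \<Rightarrow> real ^ 'n) measure" where "PB = PiM {1::nat, 2} (\<lambda>_. borel)"
  have "indep_var PA A PB B"
    unfolding A_def B_def PA_def PB_def
    by (rule indep_var_restrict[OF input_fading_noise_indep[OF N0_pos]]) auto
  then have AB: "distr M (PA \<Otimes>\<^sub>M PB) (\<lambda>w. (A w, B w)) = distr M PA A \<Otimes>\<^sub>M distr M PB B"
    and [measurable]: "A \<in> measurable M PA" "B \<in> measurable M PB"
    by (simp_all add: indep_var_distribution_eq)
  interpret B: prob_space "distr M PB B" by (rule prob_space_distr) measurable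
  have [measurable]: "(\<lambda>a. a 0) \<in> measurable PA borel" "(\<lambda>b. b 1) \<in> measurable PB borel"
    "(\<lambda>b. b 2) \<in> measurable PB borel"
    unfolding PA_def PB_def by simp_all
  define f' where "f' = (\<lambda>b::nat \<Rightarrow> real ^ 'n. f (b 1, b 2))"
  define g where "g = (\<lambda>a::nat \<Rightarrow> real ^ 'n. indicator {x i} (a 0) :: ennreal)"
  have [measurable]: "f' \<in> borel_measurable PB" "g \<in> borel_measurable PA"
    unfolding f'_def g_def by measurable
  have "(\<integral>\<^sup>+w. indicator {i} (idx w) * f (H w, Z N0 w) \<partial>M) = (\<integral>\<^sup>+w. g (A w) * f' (B w) \<partial>M)"
    using idx_eq_iff[OF _ i] by (intro nn_integral_cong) (auto simp: indicator_def f'_def g_def A_def B_def)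
  also have "\<dots> = (\<integral>\<^sup>+p. g (fst p) * f' (snd p) \<partial>distr M (PA \<Otimes>\<^sub>M PB) (\<lambda>w. (A w, B w)))"
    by (subst nn_integral_distr) auto
  also have "\<dots> = (\<integral>\<^sup>+a. g a * (\<integral>\<^sup>+b. f' b \<partial>distr M PB B) \<partial>distr M PA A)"
    unfolding AB by (subst B.nn_integral_fst[symmetric]) (auto simp: nn_integral_cmult)
  also have "\<dots> = (\<integral>\<^sup>+w. g (A w) \<partial>M) * (\<integral>\<^sup>+w. f' (B w) \<partial>M)"
    by (simp add: nn_integral_multc nn_integral_distr)
  also have "\<dots> = (\<integral>\<^sup>+w. indicator {x i} (X w) \<partial>M) * (\<integral>\<^sup>+w. f (H w, Z N0 w) \<partial>M)"
    by (simp add: f'_def g_def A_def B_def)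
  also have "(\<integral>\<^sup>+w. indicator {x i} (X w) \<partial>M) = (\<integral>\<^sup>+w. indicator {w \<in> space M. idx w = i} w \<partial>M)"
    using idx_eq_iff[OF _ i] by (intro nn_integral_cong) (auto simp: indicator_def)
  also have "\<dots> = ennreal (symbol_prob i)"
    by (simp add: emeasure_eq_measure symbol_prob_def)
  also have "(\<integral>\<^sup>+w. f (H w, Z N0 w) \<partial>M) = (\<integral>\<^sup>+b. f b \<partial>?HZ)"
    by (subst nn_integral_distr) auto
  also have "(\<integral>\<^sup>+b. f b \<partial>?HZ) = (\<integral>\<^sup>+h. (\<integral>\<^sup>+z. f (h, z) \<partial>\<gamma>) \<partial>distr M borel H)"
    unfolding distr_H_Z by (rule gamma.nn_integral_fst[symmetric]) simp
  also have "\<dots> = (\<integral>\<^sup>+w. (\<integral>\<^sup>+z. f (H w, z) \<partial>\<gamma>) \<partial>M)"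
    by (subst nn_integral_distr) auto
  finally show ?thesis .
qed

lemma nn_integral_idx_H:
  assumes i: "i < 2 ^ m" and [measurable]: "f \<in> borel_measurable borel"
  shows "(\<integral>\<^sup>+w. indicator {i} (idx w) * f (H w) \<partial>M) = ennreal (symbol_prob i) * (\<integral>\<^sup>+w. f (H w) \<partial>M)"
  using nn_integral_idx_H_Z[OF i, of "\<lambda>p. f (fst p)"] gamma.emeasure_space_1 by simp

text \<open>The likelihood ratio of the output, given symbol i and fading h, against pure
  noise.\<close>

definition lr :: "nat \<Rightarrow> real ^ 'n \<Rightarrow> real ^ 'n \<Rightarrow> real"
  where "lr i h y = gauss_tilt v (hadamard h (x i) /\<^sub>R v) y"

lemma lr_measurable [measurable (raw)]:
  assumes [measurable]: "f \<in> borel_measurable N" "g \<in> borel_measurable N"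
  shows "(\<lambda>p. lr i (f p) (g p)) \<in> borel_measurable N"
  unfolding lr_def by measurable

lemma lr_pos [simp]: "0 < lr i h y" by (simp add: lr_def)

lemma lr_nonneg [simp]: "0 \<le> lr i h y" by (simp add: lr_def)

text \<open>Given the symbol and the fading, the output is shifted noise, and the shift is traded
  for the likelihood ratio.\<close>

lemma nn_integral_idx_H_Y:
  assumes i: "i < 2 ^ m" and f [measurable]: "f \<in> borel_measurable (borel \<Otimes>\<^sub>M borel)"
  shows "(\<integral>\<^sup>+w. indicator {i} (idx w) * f (H w, Y w) \<partial>M)
    = ennreal (symbol_prob i) * (\<integral>\<^sup>+w. (\<integral>\<^sup>+y. ennreal (lr i (H w) y) * f (H w, y) \<partial>\<gamma>) \<partial>M)"
proof -
  have "(\<integral>\<^sup>+w. indicator {i} (idx w) * f (H w, Y w) \<partial>M)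
      = (\<integral>\<^sup>+w. indicator {i} (idx w) * f (H w, hadamard (H w) (x i) + Z N0 w) \<partial>M)"
    using idx(3) by (intro nn_integral_cong) (auto simp: indicator_def Y_eq)
  also have "\<dots> = ennreal (symbol_prob i) * (\<integral>\<^sup>+w. (\<integral>\<^sup>+z. f (H w, hadamard (H w) (x i) + z) \<partial>\<gamma>) \<partial>M)"
    using nn_integral_idx_H_Z[OF i, of "\<lambda>p. f (fst p, hadamard (fst p) (x i) + snd p)"] by simp
  also have "\<dots> = ennreal (symbol_prob i) * (\<integral>\<^sup>+w. (\<integral>\<^sup>+y. ennreal (lr i (H w) y) * f (H w, y) \<partial>\<gamma>) \<partial>M)"
    unfolding lr_def
    by (intro arg_cong2[of _ _ _ _ "(*)"] refl nn_integral_cong nn_integral_gauss_shift) simp_all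
  finally show ?thesis .
qed

text \<open>The density, relative to the noise law, of the output given the \<kappa>-value u of the
  index and fading h; identically 0 when the value u has probability zero.\<close>

definition mixture :: "(nat \<Rightarrow> nat) \<Rightarrow> nat \<Rightarrow> real ^ 'n \<Rightarrow> real ^ 'n \<Rightarrow> real"
  where "mixture \<kappa> u h y = (\<Sum>j<2 ^ m. cond_weight {..<2 ^ m} symbol_prob \<kappa> u j * lr j h y)"

lemma mixture_measurable [measurable (raw)]:
  assumes [measurable]: "f \<in> borel_measurable N" "g \<in> borel_measurable N"
    and u: "u \<in> measurable N (count_space UNIV)"
  shows "(\<lambda>p. mixture \<kappa> (u p) (f p) (g p)) \<in> borel_measurable N"
proof (rule measurable_compose_countable[OF _ u])
  show "(\<lambda>p. mixture \<kappa> u (f p) (g p)) \<in> borel_measurable N" for u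
    unfolding mixture_def by measurable
qed

lemma mixture_nonneg [simp]: "0 \<le> mixture \<kappa> u h y"
  unfolding mixture_def by (intro sum_nonneg mult_nonneg_nonneg cond_weight_nonneg) auto

section \<open>Conditional densities of the output\<close>

text \<open>
  Treats \<open>T = H\<close> (with \<open>\<kappa>\<close> constant) and \<open>T = (C k, H)\<close> (with \<open>\<kappa> i = c i k\<close>) at once.
\<close>

context
  fixes S :: "'t measure" and T :: "'w \<Rightarrow> 't" and \<kappa> :: "nat \<Rightarrow> nat"
    and e :: "nat \<Rightarrow> real ^ 'n \<Rightarrow> 't" and p :: "'t \<times> (real ^ 'n) \<Rightarrow> real"
  assumes T_meas [measurable]: "T \<in> measurable M S"
    and e_meas: "\<And>i. i < 2 ^ m \<Longrightarrow> e (\<kappa> i) \<in> measurable borel S"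
    and T_eq: "\<And>w. w \<in> space M \<Longrightarrow> T w = e (\<kappa> (idx w)) (H w)"
    and p_meas [measurable]: "p \<in> borel_measurable (S \<Otimes>\<^sub>M borel)"
    and p_nonneg: "\<And>z. 0 \<le> p z"
    and p_eq: "\<And>i h y. i < 2 ^ m \<Longrightarrow> p (e (\<kappa> i) h, y) = mixture \<kappa> (\<kappa> i) h y"
begin

text \<open>The law is evaluated on a set by splitting over the transmitted index. Each piece
  carries the likelihood ratio of the actual symbol; redrawing the symbol given its \<kappa>-value
  turns this into the mixture, which depends on T and the output only.\<close>

lemma joint_law_density_gauss:
  "distr M (S \<Otimes>\<^sub>M borel) (\<lambda>w. (T w, Y w)) = density (distr M S T \<Otimes>\<^sub>M \<gamma>) (\<lambda>z. ennreal (p z))"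
proof (rule measure_eqI)
  show "sets (distr M (S \<Otimes>\<^sub>M borel) (\<lambda>w. (T w, Y w))) = sets (density (distr M S T \<Otimes>\<^sub>M \<gamma>) (\<lambda>z. ennreal (p z)))"
    by (simp cong: sets_pair_measure_cong)
  fix E assume "E \<in> sets (distr M (S \<Otimes>\<^sub>M borel) (\<lambda>w. (T w, Y w)))"
  then have E [measurable]: "E \<in> sets (S \<Otimes>\<^sub>M borel)" by simp
  define F where "F = (\<lambda>j u. \<integral>\<^sup>+w. \<integral>\<^sup>+y. ennreal (lr j (H w) y) * indicator E (e u (H w), y) \<partial>\<gamma> \<partial>M)"
  have ind_meas: "(\<lambda>q. indicator E (e (\<kappa> i) (fst q), snd q) :: ennreal) \<in> borel_measurable (borel \<Otimes>\<^sub>M borel)"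
    if "i < 2 ^ m" for i
  proof -
    note [measurable] = e_meas[OF that]
    show ?thesis by measurable
  qed
  have "emeasure (distr M (S \<Otimes>\<^sub>M borel) (\<lambda>w. (T w, Y w))) E = (\<integral>\<^sup>+w. indicator E (T w, Y w) \<partial>M)"
    by (simp add: nn_integral_indicator[symmetric] nn_integral_distr del: nn_integral_indicator)
  also have "\<dots> = (\<Sum>i<2 ^ m. \<integral>\<^sup>+w. indicator {i} (idx w) * indicator E (T w, Y w) \<partial>M)"
    by (rule nn_integral_idx) measurable
  also have "\<dots> = (\<Sum>i<2 ^ m. \<integral>\<^sup>+w. indicator {i} (idx w) * indicator E (e (\<kappa> i) (H w), Y w) \<partial>M)"
    by (intro sum.cong refl nn_integral_cong) (auto simp: T_eq indicator_def)
  also have "\<dots> = (\<Sum>i<2 ^ m. ennreal (symbol_prob i) * F i (\<kappa> i))"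
    using nn_integral_idx_H_Y[OF _ ind_meas] by (intro sum.cong refl) (simp add: F_def)
  \<comment> \<open>The redraw: F j (\<kappa> i) pairs the likelihood ratio of j with the value of T
    belonging to i, and the weights vanish unless i and j share their \<kappa>-value.\<close>
  also have "\<dots> = (\<Sum>i<2 ^ m. ennreal (symbol_prob i) *
      (\<Sum>j<2 ^ m. ennreal (cond_weight {..<2 ^ m} symbol_prob \<kappa> (\<kappa> i) j) * F j (\<kappa> i)))"
    by (rule sum_regroup_ennreal[symmetric]) auto
  also have "\<dots> = (\<Sum>i<2 ^ m. ennreal (symbol_prob i) *
      (\<integral>\<^sup>+w. \<integral>\<^sup>+y. ennreal (mixture \<kappa> (\<kappa> i) (H w) y) * indicator E (e (\<kappa> i) (H w), y) \<partial>\<gamma> \<partial>M))"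
  proof (intro sum.cong refl arg_cong2[of _ _ _ _ "(*)"])
    fix i assume "i \<in> {..<2 ^ m :: nat}"
    then have [measurable]: "e (\<kappa> i) \<in> measurable borel S" using e_meas by simp
    let ?q = "cond_weight {..<2 ^ m} symbol_prob \<kappa> (\<kappa> i)"
    have "(\<integral>\<^sup>+w. \<integral>\<^sup>+y. ennreal (mixture \<kappa> (\<kappa> i) (H w) y) * indicator E (e (\<kappa> i) (H w), y) \<partial>\<gamma> \<partial>M)
        = (\<integral>\<^sup>+w. \<integral>\<^sup>+y. (\<Sum>j<2 ^ m. ennreal (?q j) * (ennreal (lr j (H w) y) * indicator E (e (\<kappa> i) (H w), y))) \<partial>\<gamma> \<partial>M)"
      unfolding mixture_def
      by (intro nn_integral_cong, subst sum_ennreal[symmetric])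
        (auto simp: cond_weight_nonneg ennreal_mult mult.assoc sum_distrib_right intro!: mult_nonneg_nonneg)
    also have "\<dots> = (\<Sum>j<2 ^ m. ennreal (?q j) * F j (\<kappa> i))"
      by (simp add: nn_integral_sum nn_integral_cmult F_def)
    finally show "(\<Sum>j<2 ^ m. ennreal (?q j) * F j (\<kappa> i))
      = (\<integral>\<^sup>+w. \<integral>\<^sup>+y. ennreal (mixture \<kappa> (\<kappa> i) (H w) y) * indicator E (e (\<kappa> i) (H w), y) \<partial>\<gamma> \<partial>M)" ..
  qed
  also have "\<dots> = (\<Sum>i<2 ^ m. \<integral>\<^sup>+w. indicator {i} (idx w) * (\<integral>\<^sup>+y. ennreal (p (T w, y)) * indicator E (T w, y) \<partial>\<gamma>) \<partial>M)"
  proof (intro sum.cong refl)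
    fix i assume i: "i \<in> {..<2 ^ m :: nat}"
    then have [measurable]: "e (\<kappa> i) \<in> measurable borel S" using e_meas by simp
    have "ennreal (symbol_prob i) *
        (\<integral>\<^sup>+w. \<integral>\<^sup>+y. ennreal (mixture \<kappa> (\<kappa> i) (H w) y) * indicator E (e (\<kappa> i) (H w), y) \<partial>\<gamma> \<partial>M)
      = (\<integral>\<^sup>+w. indicator {i} (idx w) *
          (\<integral>\<^sup>+y. ennreal (mixture \<kappa> (\<kappa> i) (H w) y) * indicator E (e (\<kappa> i) (H w), y) \<partial>\<gamma>) \<partial>M)"
      using i nn_integral_idx_H[of i "\<lambda>h. \<integral>\<^sup>+y. ennreal (mixture \<kappa> (\<kappa> i) h y) * indicator E (e (\<kappa> i) h, y) \<partial>\<gamma>"]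
      by simp
    also have "\<dots> = (\<integral>\<^sup>+w. indicator {i} (idx w) * (\<integral>\<^sup>+y. ennreal (p (T w, y)) * indicator E (T w, y) \<partial>\<gamma>) \<partial>M)"
      using i by (intro nn_integral_cong) (auto simp: T_eq p_eq indicator_def)
    finally show "ennreal (symbol_prob i) *
        (\<integral>\<^sup>+w. \<integral>\<^sup>+y. ennreal (mixture \<kappa> (\<kappa> i) (H w) y) * indicator E (e (\<kappa> i) (H w), y) \<partial>\<gamma> \<partial>M)
      = (\<integral>\<^sup>+w. indicator {i} (idx w) * (\<integral>\<^sup>+y. ennreal (p (T w, y)) * indicator E (T w, y) \<partial>\<gamma>) \<partial>M)" .
  qed
  also have "\<dots> = (\<integral>\<^sup>+w. (\<integral>\<^sup>+y. ennreal (p (T w, y)) * indicator E (T w, y) \<partial>\<gamma>) \<partial>M)"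
    by (rule nn_integral_idx[symmetric]) measurable
  also have "\<dots> = (\<integral>\<^sup>+t. (\<integral>\<^sup>+y. ennreal (p (t, y)) * indicator E (t, y) \<partial>\<gamma>) \<partial>distr M S T)"
    by (subst nn_integral_distr) auto
  also have "\<dots> = (\<integral>\<^sup>+z. ennreal (p z) * indicator E z \<partial>(distr M S T \<Otimes>\<^sub>M \<gamma>))"
    by (rule gamma.nn_integral_fst) measurable
  also have "\<dots> = emeasure (density (distr M S T \<Otimes>\<^sub>M \<gamma>) (\<lambda>z. ennreal (p z))) E"
    by (subst emeasure_density) (auto cong: sets_pair_measure_cong)
  finally show "emeasure (distr M (S \<Otimes>\<^sub>M borel) (\<lambda>w. (T w, Y w))) E
    = emeasure (density (distr M S T \<Otimes>\<^sub>M \<gamma>) (\<lambda>z. ennreal (p z))) E" .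
qed

lemma joint_law_density_lborel:
  "distr M (S \<Otimes>\<^sub>M borel) (\<lambda>w. (T w, Y w))
    = density (distr M S T \<Otimes>\<^sub>M lborel) (\<lambda>z. ennreal (gauss_density \<sigma> (snd z)) * ennreal (p z))"
proof -
  interpret T: prob_space "distr M S T" by (rule prob_space_distr) measurable
  have "distr M S T \<Otimes>\<^sub>M \<gamma> = density (distr M S T) (\<lambda>_. 1) \<Otimes>\<^sub>M density lborel (\<lambda>z. ennreal (gauss_density \<sigma> z))"
    by (simp add: density_1 gauss_def)
  also have "\<dots> = density (distr M S T \<Otimes>\<^sub>M lborel) (\<lambda>(t, y). 1 * ennreal (gauss_density \<sigma> y))"
    by (rule pair_measure_density)
      (auto intro: lborel.sigma_finite_measure_axioms gamma.sigma_finite_measure_axioms[unfolded gauss_def])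
  finally have "distr M S T \<Otimes>\<^sub>M \<gamma> = density (distr M S T \<Otimes>\<^sub>M lborel) (\<lambda>z. ennreal (gauss_density \<sigma> (snd z)))"
    by (simp add: case_prod_beta')
  then show ?thesis
    unfolding joint_law_density_gauss
    by simp (subst density_density_eq; simp)
qed

text \<open>Radon-Nikodym derivatives are unique almost everywhere for the product measure. The
  joint law is absolutely continuous with respect to it, so the identity also holds almost surely at
  the random point (T, Y).\<close>

lemma cond_density_eq:
  "AE w in M. cond_density M S T Y (T w) (Y w) = gauss_density \<sigma> (Y w) * p (T w, Y w)"
proof -
  let ?N = "distr M S T \<Otimes>\<^sub>M (lborel :: (real ^ 'n) measure)"
  let ?J = "distr M (S \<Otimes>\<^sub>M borel) (\<lambda>w. (T w, Y w))"
  let ?f = "\<lambda>z. ennreal (gauss_density \<sigma> (snd z)) * ennreal (p z)"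
  interpret T: prob_space "distr M S T" by (rule prob_space_distr) measurable
  interpret N: pair_sigma_finite "distr M S T" "lborel :: (real ^ 'n) measure" ..
  have f: "?f \<in> borel_measurable ?N" by measurable
  have "AE z in ?N. ?f z = RN_deriv ?N ?J z"
    by (rule N.RN_deriv_unique[OF f joint_law_density_lborel[symmetric]])
  then have "AE z in density ?N ?f. ?f z = RN_deriv ?N ?J z"
    by (subst AE_density[OF f]) auto
  then have "AE z in ?J. ?f z = RN_deriv ?N ?J z"
    by (simp only: joint_law_density_lborel)
  then have "AE w in M. ?f (T w, Y w) = RN_deriv ?N ?J (T w, Y w)"
    by (rule AE_distrD[rotated]) measurable
  then show ?thesis
  proof (rule AE_mp, intro AE_I2 impI)
    fix w assume eq: "?f (T w, Y w) = RN_deriv ?N ?J (T w, Y w)"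
    show "cond_density M S T Y (T w) (Y w) = gauss_density \<sigma> (Y w) * p (T w, Y w)"
      unfolding cond_density_def eq[symmetric] using p_nonneg
      by (simp add: enn2real_mult)
  qed
qed

lemma cond_density_measurable [measurable]:
  "(\<lambda>w. cond_density M S T Y (T w) (Y w)) \<in> borel_measurable M"
proof -
  let ?N = "distr M S T \<Otimes>\<^sub>M (lborel :: (real ^ 'n) measure)"
  let ?J = "distr M (S \<Otimes>\<^sub>M borel) (\<lambda>w. (T w, Y w))"
  have "RN_deriv ?N ?J \<in> borel_measurable (S \<Otimes>\<^sub>M borel)"
    using borel_measurable_RN_deriv[of ?N ?J] by (simp cong: measurable_cong_sets sets_pair_measure_cong)
  then show ?thesis unfolding cond_density_def by measurable
qed

end

end

section \<open>Expansion of the information\<close>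

context fading_bicm
begin

lemma fading_fourth_moment: "integrable M (\<lambda>w. norm (H w) ^ 4)"
proof -
  obtain r where "0 < r" "\<forall>\<^sub>F d in at_top. prob {w \<in> space M. (norm (H w))\<^sup>2 > d} \<le> exp (- (d powr r))"
    using fading_tail by blast
  then have "integrable M (\<lambda>w. ((norm (H w))\<^sup>2)\<^sup>2)"
    by (intro integrable_power2_of_tail) auto
  then show ?thesis by simp
qed

lemma fading_component_second_moment:
  "(\<integral>\<^sup>+w. ennreal ((H w $ j)\<^sup>2) \<partial>M) = ennreal (\<integral>h. h\<^sup>2 \<partial>PH)"
proof -
  have "(\<integral>\<^sup>+h. ennreal (h\<^sup>2) \<partial>PH) = ennreal (\<integral>h. h\<^sup>2 \<partial>PH)"
    using fading_square_integrable by (intro nn_integral_eq_integral) auto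
  moreover have "(\<integral>\<^sup>+w. ennreal ((H w $ j)\<^sup>2) \<partial>M) = (\<integral>\<^sup>+h. ennreal (h\<^sup>2) \<partial>distr M borel (\<lambda>w. H w $ j))"
    by (subst nn_integral_distr) auto
  ultimately show ?thesis by (simp only: fading_law)
qed

text \<open>The squared norm splits over components, so dependence between fading components does
  not enter; their common second moment factors out.\<close>

lemma fading_hadamard_second_moment:
  "(\<integral>\<^sup>+w. ennreal ((norm (hadamard (H w) b))\<^sup>2) \<partial>M) = ennreal ((\<integral>h. h\<^sup>2 \<partial>PH) * (norm b)\<^sup>2)"
proof -
  have "(norm (hadamard a b))\<^sup>2 = (\<Sum>j\<in>UNIV. (b $ j)\<^sup>2 * (a $ j)\<^sup>2)" for a
    by (simp add: norm_vec_def L2_set_def hadamard_def sum_nonneg power_mult_distrib mult.commute)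
  then have "(\<integral>\<^sup>+w. ennreal ((norm (hadamard (H w) b))\<^sup>2) \<partial>M)
      = (\<integral>\<^sup>+w. (\<Sum>j\<in>UNIV. ennreal ((b $ j)\<^sup>2) * ennreal ((H w $ j)\<^sup>2)) \<partial>M)"
    by (simp add: ennreal_mult flip: sum_ennreal)
  also have "\<dots> = (\<Sum>j\<in>UNIV. ennreal ((b $ j)\<^sup>2) * ennreal (\<integral>h. h\<^sup>2 \<partial>PH))"
    by (simp add: nn_integral_sum nn_integral_cmult fading_component_second_moment)
  also have "\<dots> = ennreal (\<Sum>j\<in>UNIV. (b $ j)\<^sup>2 * (\<integral>h. h\<^sup>2 \<partial>PH))"
    using fading_power_pos by (subst sum_ennreal[symmetric]) (auto simp: ennreal_mult)
  also have "(\<Sum>j\<in>UNIV. (b $ j)\<^sup>2 * (\<integral>h. h\<^sup>2 \<partial>PH)) = (\<integral>h. h\<^sup>2 \<partial>PH) * (norm b)\<^sup>2"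
    by (simp add: norm_vec_def L2_set_def sum_nonneg sum_distrib_left mult.commute)
  finally show ?thesis .
qed

definition cond_mean :: "(nat \<Rightarrow> nat) \<Rightarrow> nat \<Rightarrow> real ^ 'n"
  where "cond_mean \<kappa> u = (\<Sum>j<2 ^ m. cond_weight {..<2 ^ m} symbol_prob \<kappa> u j *\<^sub>R x j)"

text \<open>The second moment of the conditional expectation of X given the \<kappa>-value of the
  index.\<close>

definition "mean_energy \<kappa> = (\<Sum>i<2 ^ m. symbol_prob i * (norm (cond_mean \<kappa> (\<kappa> i)))\<^sup>2)"

text \<open>A common bound for the symbol norms; a sum serves in place of the maximum.\<close>

definition "radius = (\<Sum>i<2 ^ m. norm (x i))"

lemma norm_le_radius: "i < 2 ^ m \<Longrightarrow> norm (x i) \<le> radius"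
  unfolding radius_def by (intro member_le_sum) auto

end

section \<open>Divergence from the noise law and its average\<close>

context fading_bicm_at
begin

lemma hadamard_mean_energy:
  shows "integrable M (\<lambda>w. (norm (hadamard (H w) (cond_mean \<kappa> (\<kappa> (idx w)))))\<^sup>2)"
    and "(\<integral>w. (norm (hadamard (H w) (cond_mean \<kappa> (\<kappa> (idx w)))))\<^sup>2 \<partial>M) = (\<integral>h. h\<^sup>2 \<partial>PH) * mean_energy \<kappa>"
proof -
  have meas [measurable]: "(\<lambda>w. cond_mean \<kappa> (\<kappa> (idx w))) \<in> borel_measurable M"
    by (rule measurable_compose[OF idx_measurable]) simp
  have "(\<integral>\<^sup>+w. ennreal ((norm (hadamard (H w) (cond_mean \<kappa> (\<kappa> (idx w)))))\<^sup>2) \<partial>M)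
      = (\<Sum>i<2 ^ m. \<integral>\<^sup>+w. indicator {i} (idx w) * ennreal ((norm (hadamard (H w) (cond_mean \<kappa> (\<kappa> (idx w)))))\<^sup>2) \<partial>M)"
    by (rule nn_integral_idx) measurable
  also have "\<dots> = (\<Sum>i<2 ^ m. \<integral>\<^sup>+w. indicator {i} (idx w) * ennreal ((norm (hadamard (H w) (cond_mean \<kappa> (\<kappa> i))))\<^sup>2) \<partial>M)"
    by (intro sum.cong refl nn_integral_cong) (auto simp: indicator_def)
  also have "\<dots> = (\<Sum>i<2 ^ m. ennreal (symbol_prob i) * ennreal ((\<integral>h. h\<^sup>2 \<partial>PH) * (norm (cond_mean \<kappa> (\<kappa> i)))\<^sup>2))"
    using nn_integral_idx_H[of _ "\<lambda>h. ennreal ((norm (hadamard h _))\<^sup>2)"]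
    by (intro sum.cong refl) (simp add: fading_hadamard_second_moment)
  also have "\<dots> = ennreal ((\<integral>h. h\<^sup>2 \<partial>PH) * mean_energy \<kappa>)"
    using fading_power_pos
    by (simp add: mean_energy_def sum_distrib_left mult.left_commute flip: ennreal_mult sum_ennreal)
  finally have *: "(\<integral>\<^sup>+w. ennreal ((norm (hadamard (H w) (cond_mean \<kappa> (\<kappa> (idx w)))))\<^sup>2) \<partial>M)
      = ennreal ((\<integral>h. h\<^sup>2 \<partial>PH) * mean_energy \<kappa>)" .
  have "has_bochner_integral M (\<lambda>w. (norm (hadamard (H w) (cond_mean \<kappa> (\<kappa> (idx w)))))\<^sup>2)
      ((\<integral>h. h\<^sup>2 \<partial>PH) * mean_energy \<kappa>)"
    using fading_power_pos
    by (intro has_bochner_integral_nn_integral *) (auto simp: mean_energy_def intro!: mult_nonneg_nonneg sum_nonneg)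
  then show "integrable M (\<lambda>w. (norm (hadamard (H w) (cond_mean \<kappa> (\<kappa> (idx w)))))\<^sup>2)"
    and "(\<integral>w. (norm (hadamard (H w) (cond_mean \<kappa> (\<kappa> (idx w)))))\<^sup>2 \<partial>M) = (\<integral>h. h\<^sup>2 \<partial>PH) * mean_energy \<kappa>"
    by (auto simp: has_bochner_integral_iff)
qed

text \<open>The relative entropy, in nats, of the conditional output law against the noise law when
  u has positive probability; it is 0 otherwise.\<close>

definition divergence :: "(nat \<Rightarrow> nat) \<Rightarrow> nat \<Rightarrow> real ^ 'n \<Rightarrow> real"
  where "divergence \<kappa> u h = (\<integral>y. mixture \<kappa> u h y * ln (mixture \<kappa> u h y) \<partial>\<gamma>)"

lemma
  shows mixture_mult_ln_integrable: "integrable \<gamma> (\<lambda>y. mixture \<kappa> u h y * ln (mixture \<kappa> u h y))"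
    and divergence_expansion: "\<bar>divergence \<kappa> u h - (norm (hadamard h (cond_mean \<kappa> u)))\<^sup>2 / (2 * v)\<bar>
      \<le> 30 * (radius ^ 4 / v\<^sup>2) * norm h ^ 4"
proof -
  let ?q = "cond_weight {..<2 ^ m} symbol_prob \<kappa> u" and ?w = "\<lambda>j. hadamard h (x j) /\<^sub>R v"
  let ?d = "(norm h * radius)\<^sup>2 / v"
  have mix: "mixture \<kappa> u h y = (\<Sum>j<2 ^ m. ?q j * gauss_tilt v (?w j) y)" for y
    by (simp add: mixture_def lr_def)
  have v: "0 < v" by simp
  have vw: "v * (norm (a /\<^sub>R v))\<^sup>2 = (norm a)\<^sup>2 / v" for a :: "real ^ 'n"
    using v by (simp add: power_mult_distrib power2_eq_square[of v] field_simps)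
  have mean: "(\<Sum>j<2 ^ m. ?q j *\<^sub>R ?w j) = hadamard h (cond_mean \<kappa> u) /\<^sub>R v"
    by (simp add: cond_mean_def hadamard_sum_right scaleR_sum_right mult.commute)
  have d: "?d\<^sup>2 = radius ^ 4 / v\<^sup>2 * norm h ^ 4"
    by (simp add: power_divide power_mult_distrib flip: power_mult)
  have "integrable \<gamma> (\<lambda>y. mixture \<kappa> u h y * ln (mixture \<kappa> u h y)) \<and>
    \<bar>divergence \<kappa> u h - (norm (hadamard h (cond_mean \<kappa> u)))\<^sup>2 / (2 * v)\<bar> \<le> 30 * ?d\<^sup>2"
  proof (cases "sum symbol_prob {i \<in> {..<2 ^ m}. \<kappa> i = u} = 0")
    case True
    then have "?q j = 0" for j by (simp add: cond_weight_def)
    then have "mixture \<kappa> u h y = 0" "cond_mean \<kappa> u = 0" for y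
      by (simp_all add: mix cond_mean_def)
    moreover have "hadamard h 0 = 0" by (simp add: hadamard_def vec_eq_iff)
    ultimately show ?thesis by (simp add: divergence_def)
  next
    case False
    have q: "0 \<le> ?q j" if "j \<in> {..<2 ^ m}" for j
      using that by (intro cond_weight_nonneg) auto
    have q1: "(\<Sum>j<2 ^ m. ?q j) = 1"
      using False by (intro cond_weight_sum) auto
    have small: "v * (norm (?w j))\<^sup>2 \<le> ?d" if "j \<in> {..<2 ^ m}" for j
      unfolding vw using v norm_le_radius[of j] that
      by (intro divide_right_mono power_mono order_trans[OF norm_hadamard_le] mult_left_mono) auto
    have "v * (norm (\<Sum>j<2 ^ m. ?q j *\<^sub>R ?w j))\<^sup>2 / 2 = (norm (hadamard h (cond_mean \<kappa> u)))\<^sup>2 / (2 * v)"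
      unfolding mean vw by simp
    moreover note gamma.mixture_mult_ln_expansion[of "{..<2 ^ m}" ?q ?w ?d, OF _ q q1 small]
      gamma.mixture_mult_ln_integrable[of "{..<2 ^ m}" ?q ?w ?d, OF _ q q1 small]
    ultimately show ?thesis
      by (simp add: mix divergence_def)
  qed
  then show "integrable \<gamma> (\<lambda>y. mixture \<kappa> u h y * ln (mixture \<kappa> u h y))"
    "\<bar>divergence \<kappa> u h - (norm (hadamard h (cond_mean \<kappa> u)))\<^sup>2 / (2 * v)\<bar>
      \<le> 30 * (radius ^ 4 / v\<^sup>2) * norm h ^ 4"
    unfolding d by (auto simp: mult.assoc)
qed

lemma divergence_measurable [measurable]:
  "(\<lambda>w. divergence \<kappa> (\<kappa> (idx w)) (H w)) \<in> borel_measurable M"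
proof -
  have [measurable]: "(\<lambda>w. \<kappa> (idx w)) \<in> measurable M (count_space UNIV)"
    by (rule measurable_compose[OF idx_measurable]) simp
  show ?thesis unfolding divergence_def by measurable
qed

lemma divergence_integrable: "integrable M (\<lambda>w. divergence \<kappa> (\<kappa> (idx w)) (H w))"
proof (rule Bochner_Integration.integrable_bound)
  let ?b = "\<lambda>w. (norm (hadamard (H w) (cond_mean \<kappa> (\<kappa> (idx w)))))\<^sup>2 / (2 * v) + 30 * (radius ^ 4 / v\<^sup>2) * norm (H w) ^ 4"
  show "integrable M ?b"
    by (intro Bochner_Integration.integrable_add integrable_divide integrable_mult_right
        hadamard_mean_energy fading_fourth_moment)
  have "\<bar>divergence \<kappa> (\<kappa> (idx w)) (H w)\<bar> \<le> ?b w" for w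
  proof -
    have "0 \<le> (norm (hadamard (H w) (cond_mean \<kappa> (\<kappa> (idx w)))))\<^sup>2 / (2 * v)" by simp
    then show ?thesis using divergence_expansion[of \<kappa> "\<kappa> (idx w)" "H w"] by linarith
  qed
  then show "AE w in M. norm (divergence \<kappa> (\<kappa> (idx w)) (H w)) \<le> norm (?b w)"
    by (intro AE_I2) (simp only: real_norm_def order_trans[OF _ abs_ge_self])
qed measurable

lemma integral_divergence_expansion:
  "\<bar>(\<integral>w. divergence \<kappa> (\<kappa> (idx w)) (H w) \<partial>M) - (\<integral>h. h\<^sup>2 \<partial>PH) * mean_energy \<kappa> / (2 * v)\<bar>
    \<le> 30 * (radius ^ 4 / v\<^sup>2) * (\<integral>w. norm (H w) ^ 4 \<partial>M)"
proof -
  let ?E = "\<lambda>w. (norm (hadamard (H w) (cond_mean \<kappa> (\<kappa> (idx w)))))\<^sup>2"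
  have intE: "integrable M (\<lambda>w. ?E w / (2 * v))"
    by (intro integrable_divide hadamard_mean_energy)
  have diff: "(\<integral>w. divergence \<kappa> (\<kappa> (idx w)) (H w) \<partial>M) - (\<integral>h. h\<^sup>2 \<partial>PH) * mean_energy \<kappa> / (2 * v)
      = (\<integral>w. divergence \<kappa> (\<kappa> (idx w)) (H w) - ?E w / (2 * v) \<partial>M)"
    by (simp add: Bochner_Integration.integral_diff[OF divergence_integrable intE] hadamard_mean_energy(2))
  have "\<bar>\<integral>w. divergence \<kappa> (\<kappa> (idx w)) (H w) - ?E w / (2 * v) \<partial>M\<bar>
      \<le> (\<integral>w. 30 * (radius ^ 4 / v\<^sup>2) * norm (H w) ^ 4 \<partial>M)"
  proof (rule order_trans[OF integral_abs_bound], rule integral_mono)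
    show "integrable M (\<lambda>w. \<bar>divergence \<kappa> (\<kappa> (idx w)) (H w) - ?E w / (2 * v)\<bar>)"
      by (intro integrable_abs Bochner_Integration.integrable_diff divergence_integrable intE)
    show "integrable M (\<lambda>w. 30 * (radius ^ 4 / v\<^sup>2) * norm (H w) ^ 4)"
      by (intro integrable_mult_right fading_fourth_moment)
  qed (rule divergence_expansion)
  then show ?thesis unfolding diff by (simp only: integral_mult_right_zero)
qed

text \<open>Since p is the density of (T, Y) relative to the product of the law of T with the noise,
  the mean of ln p is the integral of p ln p, and Fubini separates the output from T.\<close>

lemma log_mixture_integral:
  shows "integrable M (\<lambda>w. ln (mixture \<kappa> (\<kappa> (idx w)) (H w) (Y w)))"
    and "(\<integral>w. ln (mixture \<kappa> (\<kappa> (idx w)) (H w) (Y w)) \<partial>M) = (\<integral>w. divergence \<kappa> (\<kappa> (idx w)) (H w) \<partial>M)"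
proof -
  define S :: "(nat \<times> (real ^ 'n)) measure" where "S = count_space UNIV \<Otimes>\<^sub>M borel"
  define T where "T = (\<lambda>w. (\<kappa> (idx w), H w))"
  define p where "p = (\<lambda>z :: (nat \<times> (real ^ 'n)) \<times> (real ^ 'n). mixture \<kappa> (fst (fst z)) (snd (fst z)) (snd z))"
  have [measurable]: "(\<lambda>w. \<kappa> (idx w)) \<in> measurable M (count_space UNIV)"
    by (rule measurable_compose[OF idx_measurable]) simp
  have T [measurable]: "T \<in> measurable M S" unfolding T_def S_def by measurable
  have p [measurable]: "p \<in> borel_measurable (S \<Otimes>\<^sub>M borel)"
    unfolding p_def S_def by measurable
  have joint: "distr M (S \<Otimes>\<^sub>M borel) (\<lambda>w. (T w, Y w)) = density (distr M S T \<Otimes>\<^sub>M \<gamma>) (\<lambda>z. ennreal (p z))"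
    by (rule joint_law_density_gauss[where \<kappa>=\<kappa> and e=Pair]) (auto simp: p_def T_def S_def)
  interpret T: prob_space "distr M S T" by (rule prob_space_distr) measurable
  interpret N: pair_sigma_finite "distr M S T" \<gamma> ..
  let ?N = "distr M S T \<Otimes>\<^sub>M \<gamma>"
  have pN: "p \<in> borel_measurable ?N" by measurable
  have "integrable ?N (\<lambda>z. p z * ln (p z))"
  proof (rule N.Fubini_integrable)
    show "(\<lambda>z. p z * ln (p z)) \<in> borel_measurable ?N" by measurable
    have int_p: "integrable \<gamma> (\<lambda>y. p (t, y) * ln (p (t, y)))" for t
      by (simp add: p_def mixture_mult_ln_integrable)
    then show "AE t in distr M S T. integrable \<gamma> (\<lambda>y. p (t, y) * ln (p (t, y)))"
      by (intro AE_I2)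
    define J where "J = (\<lambda>w. \<integral>y. norm (p (T w, y) * ln (p (T w, y))) \<partial>\<gamma>)"
    have J_meas [measurable]: "J \<in> borel_measurable M"
      unfolding J_def by measurable
    have J_nonneg: "0 \<le> J w" for w unfolding J_def by simp
    have J_le: "J w \<le> divergence \<kappa> (\<kappa> (idx w)) (H w) + 2" for w
    proof -
      \<comment> \<open>Because t ln t \<ge> t - 1 \<ge> -1, the absolute value exceeds t ln t by at
        most 2, so integrability of the divergence suffices for Fubini.\<close>
      have "norm (p z * ln (p z)) \<le> p z * ln (p z) + 2" for z
      proof (cases "p z = 0")
        case False
        then have "0 < p z" using mixture_nonneg by (auto simp: p_def less_le)
        from mult_ln_tangent[OF this, of 1] this show ?thesis
          by (simp only: real_norm_def ln_one) linarith
      qed simp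
      then have "J w \<le> (\<integral>y. p (T w, y) * ln (p (T w, y)) + 2 \<partial>\<gamma>)"
        unfolding J_def using int_p by (intro integral_mono) auto
      also have "\<dots> = (\<integral>y. p (T w, y) * ln (p (T w, y)) \<partial>\<gamma>) + 2"
        using int_p gamma.prob_space by simp
      also have "\<dots> = divergence \<kappa> (\<kappa> (idx w)) (H w) + 2"
        by (simp add: divergence_def p_def T_def)
      finally show ?thesis .
    qed
    have "integrable M J"
    proof (rule Bochner_Integration.integrable_bound)
      show "integrable M (\<lambda>w. divergence \<kappa> (\<kappa> (idx w)) (H w) + 2)"
        by (intro Bochner_Integration.integrable_add divergence_integrable) simp
      show "AE w in M. norm (J w) \<le> norm (divergence \<kappa> (\<kappa> (idx w)) (H w) + 2)"
      proof (rule AE_I2)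
        show "norm (J w) \<le> norm (divergence \<kappa> (\<kappa> (idx w)) (H w) + 2)" for w
          using J_nonneg[of w] J_le[of w] by simp
      qed
    qed measurable
    then have "integrable M (\<lambda>w. \<integral>y. norm (p (T w, y) * ln (p (T w, y))) \<partial>\<gamma>)"
      by (simp only: J_def)
    then show "integrable (distr M S T) (\<lambda>t. \<integral>y. norm (p (t, y) * ln (p (t, y))) \<partial>\<gamma>)"
      by (subst integrable_distr_eq) auto
  qed
  note int = this
  have p_nonneg: "0 \<le> p z" for z by (simp add: p_def)
  have "integrable (distr M (S \<Otimes>\<^sub>M borel) (\<lambda>w. (T w, Y w))) (\<lambda>z. ln (p z))"
    unfolding joint using int by (subst integrable_density) (auto simp: p_nonneg)
  then have "integrable M (\<lambda>w. ln (p (T w, Y w)))"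
    by (subst (asm) integrable_distr_eq) auto
  then show "integrable M (\<lambda>w. ln (mixture \<kappa> (\<kappa> (idx w)) (H w) (Y w)))"
    by (simp add: p_def T_def)
  have "(\<integral>w. ln (p (T w, Y w)) \<partial>M) = (\<integral>z. ln (p z) \<partial>distr M (S \<Otimes>\<^sub>M borel) (\<lambda>w. (T w, Y w)))"
    by (subst integral_distr) auto
  also have "\<dots> = (\<integral>z. p z * ln (p z) \<partial>?N)"
    unfolding joint by (subst integral_density) (auto simp: p_nonneg)
  also have "\<dots> = (\<integral>t. (\<integral>y. p (t, y) * ln (p (t, y)) \<partial>\<gamma>) \<partial>distr M S T)"
    by (rule N.integral_fst'[symmetric, OF int])
  also have "\<dots> = (\<integral>w. (\<integral>y. p (T w, y) * ln (p (T w, y)) \<partial>\<gamma>) \<partial>M)"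
    by (subst integral_distr) auto
  finally show "(\<integral>w. ln (mixture \<kappa> (\<kappa> (idx w)) (H w) (Y w)) \<partial>M) = (\<integral>w. divergence \<kappa> (\<kappa> (idx w)) (H w) \<partial>M)"
    by (simp add: p_def T_def divergence_def)
qed

end

section \<open>Bits, symbols and conditional means\<close>

context fading_bicm
begin

lemma label_bit: "i < 2 ^ m \<Longrightarrow> k < m \<Longrightarrow> c i k \<in> {0, 1}"
proof -
  assume i: "i < 2 ^ m" and k: "k < m"
  have "restrict (c i) {..<m} \<in> {..<m} \<rightarrow>\<^sub>E {0, 1}"
    using bij_betwE[OF labeling] i by blast
  then have "restrict (c i) {..<m} k \<in> {0, 1}" using k by (blast intro: PiE_mem)
  then show ?thesis using k by simp
qed

lemma prob_idx: "prob {w \<in> space M. Q (idx w)} = sum symbol_prob {i \<in> {..<2 ^ m}. Q i}"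
proof -
  have "{w \<in> space M. Q (idx w)} = (\<Union>i\<in>{i \<in> {..<2 ^ m}. Q i}. {w \<in> space M. idx w = i})"
    using idx(1) by auto
  then show ?thesis
    unfolding symbol_prob_def
    by (simp only:) (rule finite_measure_finite_Union, auto simp: disjoint_family_on_def)
qed

lemma symbol_prob_sum: "(\<Sum>i<2 ^ m. symbol_prob i) = 1"
  using prob_idx[of "\<lambda>_. True"] prob_space by (simp add: lessThan_def)

text \<open>Deterministic bits give some symbols probability zero. Discarding them almost surely
  makes the mixtures positive at the transmitted label, so that their logarithms can be
  split.\<close>

lemma AE_symbol_prob_pos: "AE w in M. 0 < symbol_prob (idx w)"
proof -
  have "AE w in M. idx w = i \<longrightarrow> 0 < symbol_prob i" for i
  proof (cases "symbol_prob i = 0")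
    case True
    then have "AE w in M. w \<notin> {w \<in> space M. idx w = i}"
      by (intro AE_not_in) (simp add: symbol_prob_def emeasure_eq_measure null_sets_def)
    then show ?thesis using AE_space by eventually_elim auto
  next
    case False
    then show ?thesis using symbol_prob_nonneg[of i] by (auto simp: less_le)
  qed
  then have "AE w in M. \<forall>i. idx w = i \<longrightarrow> 0 < symbol_prob i"
    by (subst AE_all_countable) simp
  then show ?thesis by simp
qed

text \<open>Serves both the mean of X (g = 1) and its mean given a bit (g a normalised
  indicator).\<close>

lemma integral_idx_scaleR_X:
  fixes g :: "nat \<Rightarrow> real"
  shows "(\<integral>w. g (idx w) *\<^sub>R X w \<partial>M) = (\<Sum>i<2 ^ m. (symbol_prob i * g i) *\<^sub>R x i)"
proof -
  have "g (idx w) *\<^sub>R X w = (\<Sum>i<2 ^ m. indicator {w \<in> space M. idx w = i} w *\<^sub>R (g i *\<^sub>R x i))"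
    if w: "w \<in> space M" for w
  proof -
    have "(\<Sum>i<2 ^ m. indicator {w \<in> space M. idx w = i} w *\<^sub>R (g i *\<^sub>R x i))
        = (\<Sum>i<2 ^ m. if i = idx w then g i *\<^sub>R x i else 0)"
      using w by (intro sum.cong) auto
    then show ?thesis using idx[OF w] by simp
  qed
  then have "(\<integral>w. g (idx w) *\<^sub>R X w \<partial>M)
      = (\<integral>w. (\<Sum>i<2 ^ m. indicator {w \<in> space M. idx w = i} w *\<^sub>R (g i *\<^sub>R x i)) \<partial>M)"
    by (rule Bochner_Integration.integral_cong[OF refl])
  also have "\<dots> = (\<Sum>i<2 ^ m. (symbol_prob i) *\<^sub>R (g i *\<^sub>R x i))"
  proof (subst Bochner_Integration.integral_sum)
    show "integrable M (\<lambda>w. indicat_real {w \<in> space M. idx w = i} w *\<^sub>R (g i *\<^sub>R x i))" for i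
      by (intro integrable_scaleR_left integrable_real_indicator) (auto simp: emeasure_eq_measure)
    have "(\<integral>w. indicat_real {w \<in> space M. idx w = i} w *\<^sub>R (g i *\<^sub>R x i) \<partial>M)
        = symbol_prob i *\<^sub>R (g i *\<^sub>R x i)" for i
      by (subst integral_scaleR_left) (auto simp: symbol_prob_def emeasure_eq_measure intro!: integrable_real_indicator)
    then show "(\<Sum>i<2 ^ m. \<integral>w. indicat_real {w \<in> space M. idx w = i} w *\<^sub>R (g i *\<^sub>R x i) \<partial>M)
        = (\<Sum>i<2 ^ m. (symbol_prob i) *\<^sub>R (g i *\<^sub>R x i))"
      by simp
  qed
  finally show ?thesis by simp
qed

lemma prob_bit: "k < m \<Longrightarrow> prob {w \<in> space M. C k w = u} = sum symbol_prob {i \<in> {..<2 ^ m}. c i k = u}"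
  using prob_idx[of "\<lambda>i. c i k = u"] idx(2) by (auto cong: conj_cong)

lemma event_expectation_bit:
  assumes k: "k < m" and pos: "prob {w \<in> space M. C k w = u} \<noteq> 0"
  shows "event_expectation M {w \<in> space M. C k w = u} X = cond_mean (\<lambda>i. c i k) u"
proof -
  let ?A = "{w \<in> space M. C k w = u}"
  let ?g = "\<lambda>i. if c i k = u then 1 / prob ?A else 0"
  have A: "?A = {w \<in> space M. c (idx w) k = u}" using idx(2) k by auto
  have A_sets [measurable]: "?A \<in> sets M" unfolding A by measurable
  have "uniform_measure M ?A = density M (\<lambda>w. ennreal (indicator ?A w / prob ?A))"
    unfolding uniform_measure_def using pos
    by (intro density_cong) (auto simp: emeasure_eq_measure indicator_def divide_ennreal measure_nonneg zero_less_measure_iff simp flip: ennreal_1)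
  then have "event_expectation M ?A X = (\<integral>w. (indicator ?A w / prob ?A) *\<^sub>R X w \<partial>M)"
    unfolding event_expectation_def by (simp add: integral_density)
  also have "\<dots> = (\<integral>w. ?g (idx w) *\<^sub>R X w \<partial>M)"
    using idx(2) k by (intro Bochner_Integration.integral_cong) auto
  also have "\<dots> = cond_mean (\<lambda>i. c i k) u"
    unfolding integral_idx_scaleR_X[of ?g] cond_mean_def
    by (intro sum.cong) (auto simp: cond_weight_def prob_bit[OF k])
  finally show ?thesis .
qed

lemma mean_energy_bit:
  assumes k: "k < m"
  shows "mean_energy (\<lambda>i. c i k) = (\<Sum>u\<in>{0, 1}. prob {w \<in> space M. C k w = u} *
    (norm (event_expectation M {w \<in> space M. C k w = u} X))\<^sup>2)"
proof -
  have "mean_energy (\<lambda>i. c i k)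
      = (\<Sum>u\<in>{0, 1}. \<Sum>i\<in>{i \<in> {..<2 ^ m}. c i k = u}. symbol_prob i * (norm (cond_mean (\<lambda>i. c i k) (c i k)))\<^sup>2)"
  proof -
    have "(\<lambda>i. c i k) ` {..<2 ^ m} \<subseteq> {0, 1}" by (rule image_subsetI) (simp only: lessThan_iff label_bit k)
    from sum.group[OF _ _ this, where h="\<lambda>i. symbol_prob i * (norm (cond_mean (\<lambda>i. c i k) (c i k)))\<^sup>2"]
    show ?thesis by (simp only: mean_energy_def finite_lessThan finite.intros)
  qed
  also have "\<dots> = (\<Sum>u\<in>{0, 1}. prob {w \<in> space M. C k w = u} * (norm (cond_mean (\<lambda>i. c i k) u))\<^sup>2)"
    by (intro sum.cong refl) (simp add: prob_bit[OF k] sum_distrib_right)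
  also have "\<dots> = (\<Sum>u\<in>{0, 1}. prob {w \<in> space M. C k w = u} *
    (norm (event_expectation M {w \<in> space M. C k w = u} X))\<^sup>2)"
  proof (rule sum.cong[OF refl])
    fix u
    show "prob {w \<in> space M. C k w = u} * (norm (cond_mean (\<lambda>i. c i k) u))\<^sup>2
        = prob {w \<in> space M. C k w = u} * (norm (event_expectation M {w \<in> space M. C k w = u} X))\<^sup>2"
      \<comment> \<open>On a null event the two conditional means need no comparison, as both carry
        weight zero.\<close>
      using event_expectation_bit[OF k, of u] by (cases "prob {w \<in> space M. C k w = u} = 0") simp_all
  qed
  finally show ?thesis .
qed

lemma mean_energy_const: "mean_energy (\<lambda>_. 0) = (norm (\<integral>w. X w \<partial>M))\<^sup>2"
proof -
  have "(\<integral>w. X w \<partial>M) = (\<Sum>i<2 ^ m. symbol_prob i *\<^sub>R x i)"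
    using integral_idx_scaleR_X[of "\<lambda>_. 1"] by simp
  then show ?thesis
    using symbol_prob_sum
    by (simp add: mean_energy_def cond_mean_def cond_weight_def lessThan_def flip: sum_distrib_right)
qed

end

section \<open>The information as a sum of divergences\<close>

context fading_bicm_at
begin

lemma mixture_pos:
  assumes "0 < symbol_prob i" "i < 2 ^ m"
  shows "0 < mixture \<kappa> (\<kappa> i) h y"
proof -
  have "0 < sum symbol_prob {j \<in> {..<2 ^ m}. \<kappa> j = \<kappa> i}"
    using assms by (intro sum_pos2[of _ i]) auto
  then have "0 < cond_weight {..<2 ^ m} symbol_prob \<kappa> (\<kappa> i) i * lr i h y"
    using assms by (simp add: cond_weight_def)
  then show ?thesis
    unfolding mixture_def using assms(2)
    by (intro sum_pos2[of _ i]) (auto intro!: mult_nonneg_nonneg cond_weight_nonneg)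
qed

lemma
  shows cond_density_fading: "AE w in M. cond_density M borel H Y (H w) (Y w)
      = gauss_density \<sigma> (Y w) * mixture (\<lambda>_. 0) 0 (H w) (Y w)"
    and cond_density_fading_measurable [measurable]:
      "(\<lambda>w. cond_density M borel H Y (H w) (Y w)) \<in> borel_measurable M"
proof -
  let ?p = "\<lambda>z :: (real ^ 'n) \<times> (real ^ 'n). mixture (\<lambda>_. 0) 0 (fst z) (snd z)"
  have p: "?p \<in> borel_measurable (borel \<Otimes>\<^sub>M borel)" by measurable
  show "AE w in M. cond_density M borel H Y (H w) (Y w)
      = gauss_density \<sigma> (Y w) * mixture (\<lambda>_. 0) 0 (H w) (Y w)"
    using cond_density_eq[where T=H and S=borel and \<kappa>="\<lambda>_. 0" and e="\<lambda>_ h. h" and p="?p"] p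
    by simp
  show "(\<lambda>w. cond_density M borel H Y (H w) (Y w)) \<in> borel_measurable M"
    by (rule cond_density_measurable[where T=H and S=borel and \<kappa>="\<lambda>_. 0" and e="\<lambda>_ h. h" and p="?p"])
      (simp_all add: p)
qed

lemma
  assumes k: "k < m"
  defines "S \<equiv> count_space {0, 1} \<Otimes>\<^sub>M (borel :: (real ^ 'n) measure)"
  shows cond_density_bit_fading: "AE w in M. cond_density M S (\<lambda>w. (C k w, H w)) Y (C k w, H w) (Y w)
      = gauss_density \<sigma> (Y w) * mixture (\<lambda>i. c i k) (c (idx w) k) (H w) (Y w)"
    and cond_density_bit_fading_measurable:
      "(\<lambda>w. cond_density M S (\<lambda>w. (C k w, H w)) Y (C k w, H w) (Y w)) \<in> borel_measurable M"
proof -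
  let ?T = "\<lambda>w. (C k w, H w)" and ?\<kappa> = "\<lambda>i. c i k"
  let ?p = "\<lambda>z :: (nat \<times> (real ^ 'n)) \<times> (real ^ 'n). mixture ?\<kappa> (fst (fst z)) (snd (fst z)) (snd z)"
  note [measurable] = C_measurable[OF k]
  have T: "?T \<in> measurable M S" unfolding S_def by measurable
  have u: "(\<lambda>z. fst (fst z)) \<in> measurable (S \<Otimes>\<^sub>M (borel :: (real ^ 'n) measure)) (count_space UNIV)"
    unfolding S_def
    by (rule measurable_compose[OF measurable_fst], rule measurable_compose[OF measurable_fst]) simp
  have p: "?p \<in> borel_measurable (S \<Otimes>\<^sub>M borel)"
    unfolding S_def by (intro mixture_measurable u[unfolded S_def]) measurable
  have e: "Pair (c i k) \<in> measurable borel S" if "i < 2 ^ m" for i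
    using label_bit[OF that k] unfolding S_def by (intro measurable_Pair1') auto
  have T_eq: "?T w = (c (idx w) k, H w)" if "w \<in> space M" for w
    using idx(2)[OF that k] by simp
  have "AE w in M. cond_density M S ?T Y (?T w) (Y w) = gauss_density \<sigma> (Y w) * ?p (?T w, Y w)"
    by (rule cond_density_eq[where \<kappa>="?\<kappa>" and e=Pair, OF T e T_eq p]) auto
  then show "AE w in M. cond_density M S ?T Y (?T w) (Y w)
      = gauss_density \<sigma> (Y w) * mixture ?\<kappa> (c (idx w) k) (H w) (Y w)"
    using AE_space by eventually_elim (simp add: T_eq)
  show "(\<lambda>w. cond_density M S ?T Y (?T w) (Y w)) \<in> borel_measurable M"
    by (rule cond_density_measurable[where \<kappa>="?\<kappa>" and e=Pair, OF T e T_eq p]) auto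
qed

text \<open>The noise density cancels in the quotient of the conditional densities, and each
  remaining logarithm is integrable by itself, so the expectation splits into two mean
  divergences.\<close>

lemma bicm_information_eq:
  "bicm_information M m C H Y = (\<Sum>k<m.
    ((\<integral>w. divergence (\<lambda>i. c i k) (c (idx w) k) (H w) \<partial>M) - (\<integral>w. divergence (\<lambda>_. 0) 0 (H w) \<partial>M)) / ln 2)"
  unfolding bicm_information_def
proof (intro sum.cong refl)
  fix k assume "k \<in> {..<m}"
  then have k: "k < m" by simp
  let ?f = "\<lambda>w. cond_density M (count_space {0, 1} \<Otimes>\<^sub>M borel) (\<lambda>w. (C k w, H w)) Y (C k w, H w) (Y w)"
  let ?g = "\<lambda>w. cond_density M borel H Y (H w) (Y w)"
  let ?a = "\<lambda>w. mixture (\<lambda>i. c i k) (c (idx w) k) (H w) (Y w)" and ?b = "\<lambda>w. mixture (\<lambda>_. 0) 0 (H w) (Y w)"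
  note a = log_mixture_integral[of "\<lambda>i. c i k"] and b = log_mixture_integral[of "\<lambda>_. 0"]
  have "AE w in M. log 2 (?f w / ?g w) = (ln (?a w) - ln (?b w)) / ln 2"
    using cond_density_bit_fading[OF k] cond_density_fading AE_symbol_prob_pos AE_space
  proof eventually_elim
    case (elim w)
    have "0 < ?a w" "0 < ?b w"
      using mixture_pos[of "idx w" "\<lambda>i. c i k"] mixture_pos[of "idx w" "\<lambda>_. 0"] elim idx(1) by auto
    then show ?case
      using gauss_density_pos[OF sigma_pos, of "Y w"] unfolding elim(1,2)
      by (simp add: log_def ln_div)
  qed
  moreover have "(\<lambda>w. log 2 (?f w / ?g w)) \<in> borel_measurable M"
    by (intro borel_measurable_log borel_measurable_divide borel_measurable_const
        cond_density_bit_fading_measurable[OF k] cond_density_fading_measurable)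
  moreover have "(\<lambda>w. (ln (?a w) - ln (?b w)) / ln 2) \<in> borel_measurable M"
    by (intro borel_measurable_divide borel_measurable_diff borel_measurable_integrable[OF a(1)]
        borel_measurable_integrable[OF b(1)] borel_measurable_const)
  ultimately have "(\<integral>w. log 2 (?f w / ?g w) \<partial>M) = (\<integral>w. (ln (?a w) - ln (?b w)) / ln 2 \<partial>M)"
    by (intro integral_cong_AE)
  also have "\<dots> = ((\<integral>w. divergence (\<lambda>i. c i k) (c (idx w) k) (H w) \<partial>M) - (\<integral>w. divergence (\<lambda>_. 0) 0 (H w) \<partial>M)) / ln 2"
    using a b by simp
  finally show "(\<integral>w. log 2 (?f w / ?g w) \<partial>M) = \<dots>" .
qed

lemma bicm_information_expansion:
  "\<bar>bicm_information M m C H Y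
      - (\<integral>h. h\<^sup>2 \<partial>PH) * ((\<Sum>k<m. mean_energy (\<lambda>i. c i k)) - real m * mean_energy (\<lambda>_. 0)) / (N0 * ln 2)\<bar>
    \<le> real m * (240 * radius ^ 4 * (\<integral>w. norm (H w) ^ 4 \<partial>M)) / (N0\<^sup>2 * ln 2)"
proof -
  define J where "J = (\<lambda>\<kappa>. \<integral>w. divergence \<kappa> (\<kappa> (idx w)) (H w) \<partial>M)"
  define E2 where "E2 = (\<integral>h. h\<^sup>2 \<partial>PH)"
  \<comment> \<open>With v = N0 / 2 the constant 30 / v^2 becomes 120 / N0^2, and the two
    divergences per bit double it to 240.\<close>
  define B where "B = 120 * radius ^ 4 * (\<integral>w. norm (H w) ^ 4 \<partial>M) / N0\<^sup>2"
  have J: "\<bar>J \<kappa> - E2 * mean_energy \<kappa> / N0\<bar> \<le> B" for \<kappa>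
    using integral_divergence_expansion[of \<kappa>] N0_pos
    by (simp add: J_def E2_def B_def v_eq power_divide field_simps)
  have "bicm_information M m C H Y
      - E2 * ((\<Sum>k<m. mean_energy (\<lambda>i. c i k)) - real m * mean_energy (\<lambda>_. 0)) / (N0 * ln 2)
    = (\<Sum>k<m. ((J (\<lambda>i. c i k) - E2 * mean_energy (\<lambda>i. c i k) / N0)
        - (J (\<lambda>_. 0) - E2 * mean_energy (\<lambda>_. 0) / N0)) / ln 2)"
  proof -
    have alg: "(\<Sum>k<m. (f k - j) / l) - E2 * ((\<Sum>k<m. g k) - real m * e) / (N0 * l)
        = (\<Sum>k<m. ((f k - E2 * g k / N0) - (j - E2 * e / N0)) / l)" for f g :: "nat \<Rightarrow> real" and j e l
      by (simp add: sum_subtractf flip: sum_divide_distrib sum_distrib_left)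
        (simp add: diff_divide_distrib right_diff_distrib mult.commute mult.left_commute)
    show ?thesis
      unfolding bicm_information_eq J_def by (rule alg)
  qed
  also have "\<bar>\<dots>\<bar> \<le> (\<Sum>k<m. 2 * B / ln 2)"
  proof (rule order_trans[OF sum_abs], rule sum_mono)
    fix k
    have "\<bar>(J (\<lambda>i. c i k) - E2 * mean_energy (\<lambda>i. c i k) / N0)
        - (J (\<lambda>_. 0) - E2 * mean_energy (\<lambda>_. 0) / N0)\<bar> \<le> 2 * B"
      using J[of "\<lambda>i. c i k"] J[of "\<lambda>_. 0"] by linarith
    then show "\<bar>((J (\<lambda>i. c i k) - E2 * mean_energy (\<lambda>i. c i k) / N0)
        - (J (\<lambda>_. 0) - E2 * mean_energy (\<lambda>_. 0) / N0)) / ln 2\<bar> \<le> 2 * B / ln 2"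
      by (simp add: abs_divide divide_right_mono)
  qed
  also have "\<dots> = real m * (240 * radius ^ 4 * (\<integral>w. norm (H w) ^ 4 \<partial>M)) / (N0\<^sup>2 * ln 2)"
    by (simp add: B_def)
  finally show ?thesis by (simp only: E2_def)
qed

end

section \<open>The first-order coefficient\<close>

text \<open>Two distinct coefficients would make s itself O(s^2), hence o(s), near 0.\<close>

lemma first_order_coefficient_unique:
  assumes "first_order_coefficient f a" "first_order_coefficient f b"
  shows "a = b"
proof (rule ccontr)
  assume "a \<noteq> b"
  have "(\<lambda>s. (f s - a * s) - (f s - b * s)) \<in> O[at_right 0](\<lambda>s. s\<^sup>2)"
    using assms unfolding first_order_coefficient_def by (rule sum_in_bigo)
  then have "(\<lambda>s. (b - a) * s) \<in> O[at_right 0](\<lambda>s. s\<^sup>2)"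
    by (simp add: algebra_simps)
  then have "(\<lambda>s::real. s) \<in> O[at_right 0](\<lambda>s. s\<^sup>2)"
    using \<open>a \<noteq> b\<close> by simp
  also have "(\<lambda>s::real. s\<^sup>2) \<in> o[at_right 0](\<lambda>s. s)"
    by real_asymp
  finally have "\<forall>\<^sub>F s in at_right (0::real). s = 0"
    by (simp add: landau_o.small_refl_iff)
  moreover have "\<forall>\<^sub>F s in at_right (0::real). s \<noteq> 0"
    by (auto simp: eventually_at_filter)
  ultimately have "\<forall>\<^sub>F s in at_right (0::real). False"
    by eventually_elim simp
  then show False by simp
qed

lemma (in fading_bicm) first_order_coefficient_bicm_capacity:
  "first_order_coefficient (bicm_capacity M m C X H PH Z)
    (((\<Sum>k<m. mean_energy (\<lambda>i. c i k)) - real m * mean_energy (\<lambda>_. 0)) / (symbol_energy M X * ln 2))"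
  unfolding first_order_coefficient_def
proof (rule bigoI, rule eventually_at_rightI[of 0 1])
  define E2 where "E2 = (\<integral>h. h\<^sup>2 \<partial>PH)"
  define Es where "Es = symbol_energy M X"
  have pos: "0 < E2" "0 < Es"
    using fading_power_pos energy_pos by (simp_all add: E2_def Es_def symbol_energy_def)
  define G where "G = (\<Sum>k<m. mean_energy (\<lambda>i. c i k)) - real m * mean_energy (\<lambda>_. 0)"
  define K where "K = real m * (240 * radius ^ 4 * (\<integral>w. norm (H w) ^ 4 \<partial>M))"
  fix s :: real assume "s \<in> {0<..<1}"
  then have s: "0 < s" by simp
  \<comment> \<open>The noise level is chosen separately for each s. Substituting it cancels the
    fading power \<open>E2\<close> in the leading term, and the error gets the constant K / ((E2
    Es)^2 ln 2), which is free of s.\<close>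
  define N0 where "N0 = E2 * Es / s"
  have N0: "0 < N0" using pos s by (simp add: N0_def)
  interpret fading_bicm_at M m x c C X H PH Z N0
    by unfold_locales (rule N0)
  have cap: "bicm_capacity M m C X H PH Z s = bicm_information M m C H (channel_output H X (Z N0))"
    by (simp add: bicm_capacity_def N0_def E2_def Es_def)
  have "\<bar>bicm_capacity M m C X H PH Z s - E2 * G / (N0 * ln 2)\<bar> \<le> K / (N0\<^sup>2 * ln 2)"
    using bicm_information_expansion unfolding cap E2_def G_def K_def .
  moreover have "E2 * G / (N0 * ln 2) = G / (Es * ln 2) * s"
    using pos s by (simp add: N0_def)
  moreover have "K / (N0\<^sup>2 * ln 2) = K / ((E2 * Es)\<^sup>2 * ln 2) * s\<^sup>2"
    using pos s by (simp add: N0_def power_divide)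
  ultimately show "norm (bicm_capacity M m C X H PH Z s - G / (Es * ln 2) * s)
      \<le> K / ((E2 * Es)\<^sup>2 * ln 2) * norm (s\<^sup>2)"
    by simp
qed simp

theorem theorem9:
  fixes M :: "'w measure" and m :: nat
    and x :: "nat \<Rightarrow> real ^ 'n" and c :: "nat \<Rightarrow> nat \<Rightarrow> nat"
    and C :: "nat \<Rightarrow> 'w \<Rightarrow> nat" and X H :: "'w \<Rightarrow> real ^ 'n"
    and PH :: "real measure" and Z :: "real \<Rightarrow> 'w \<Rightarrow> real ^ 'n"
  assumes "fading_bicm M m x c C X H PH Z"
  shows "\<forall>\<alpha>. first_order_coefficient (bicm_capacity M m C X H PH Z) \<alpha> \<longleftrightarrow>
    \<alpha> = log 2 (exp 1) / symbol_energy M X *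
      ((\<Sum>k<m. \<Sum>u\<in>{0, 1}. measure M {w \<in> space M. C k w = u} *
          (norm (event_expectation M {w \<in> space M. C k w = u} X))\<^sup>2)
       - real m * (norm (\<integral>w. X w \<partial>M))\<^sup>2)"
    (is "\<forall>\<alpha>. _ \<longleftrightarrow> \<alpha> = ?\<beta>")
proof -
  interpret fading_bicm M m x c C X H PH Z by fact
  have "first_order_coefficient (bicm_capacity M m C X H PH Z) ?\<beta>"
    using first_order_coefficient_bicm_capacity
    by (simp add: mean_energy_bit mean_energy_const log_def mult.commute)
  then show ?thesis
    using first_order_coefficient_unique by blast
qed

end
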